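(* Let $d,m\ge 1$ be integers, $\hat\alpha=(\alpha_1,\dots,\alpha_d)\in(0,1]^d$, $r_j>0$ for $1\le j\le m$, $r=\max_{1\le j\le m} r_j$, and let $\tau_j:[0,\infty)\to[0,r_j]$ be continuous for $1\le j\le m$. Let $f:\mathbb{R}^d\to\mathbb{R}^d$ be cooperative and homogeneous of degree $p\ge 1$. For $1\le j\le m$ let $g^{(j)}:\mathbb{R}^d\to\mathbb{R}^d$ be continuous on $\mathbb{R}^d$, continuously differentiable on $\mathbb{R}^d\setminus\{0\}$, order-preserving on $\mathbb{R}^d_{\ge 0}$, and homogeneous of degree $q_j\ge p$. Suppose there exists a vector $v\succ 0$ with $f(v)+\sum_{j=1}^m g^{(j)}(v)\prec 0$. Consider the system $$ {}^{C}D^{\hat\alpha}_{0^+}w(t)=f(w(t))+\sum_{j=1}^m g^{(j)}(w(t-\tau_j(t))),\ t>0,\qquad w(s)=\varphi(s),\ s\in[-r,0], $$ with initial conditions $\varphi\in C([-r,0];\mathbb{R}^d_{\ge0})$, and denote its solution by $\Phi(\cdot,\varphi)$. Then the trivial solution is locally Mittag-Leffler stable: there exist $\delta>0$ and $\beta>0$ (independent of $\varphi$) such that for every $\varphi\in C([-r,0];\mathbb{R}^d_{\ge 0})$ with $\sup_{s\in[-r,0]}\|\varphi(s)\|<\delta$, the solution $\Phi(\cdot,\varphi)$ exists on $[0,\infty)$ and there are constants $c,\nu>0$ (which may depend on $\varphi$ and on the data of the system) with $$ \|\Phi(t,\varphi)\|\le \nu\,E_\beta(-c\,t^\beta)\quad\text{for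 all } t\ge 0 . $$
   Context: Order on $\mathbb{R}^d$: $u\preceq w$ (equivalently $w\succeq u$) means $u_i\le w_i$ for all $i$; $u\prec w$ (equivalently $w\succ u$) means $u_i<w_i$ for all $i$. $\mathbb{R}^d_{\ge0}=\{x\in\mathbb{R}^d: x\succeq 0\}$. $\|\cdot\|$ is the Euclidean norm on $\mathbb{R}^d$. A vector field $f:\mathbb{R}^d\to\mathbb{R}^d$ is cooperative if it is continuous on $\mathbb{R}^d$, continuously differentiable on $\mathbb{R}^d\setminus\{0\}$, and its Jacobian matrix $Df(x)$ is Metzler (all off-diagonal entries nonnegative) for every $x\in\mathbb{R}^d_{\ge0}\setminus\{0\}$. A vector field $h$ is homogeneous of degree $p$ if $h(\lambda x)=\lambda^p h(x)$ for all $x\in\mathbb{R}^d$, $\lambda>0$. $h$ is order-preserving on $\mathbb{R}^d_{\ge0}$ if $h(u)\succeq h(v)$ whenever $u,v\in\mathbb{R}^d_{\ge0}$ and $u\succeq v$. Fractional calculus: for $\alpha>0$, $I^{\alpha}_{0^+}x(t)=\frac1{\Gamma(\alpha)}\int_0^t(t-s)^{\alpha-1}x(s)\,ds$, with $I^0_{0^+}$ the identity. For $\alpha\in(0,1]$, the Caputo derivative is ${}^{C}D^{\alpha}_{0^+}x(t)=\frac{d}{dt}I^{1-\alpha}_{0^+}(x(\cdot)-x(0))(t)$, $t>0$ (for $\alpha=1$ it is the ordinary derivative). For $\hat\alpha=(\alpha_1,\dots,\alpha_d)$ and $w=(w_1,\dots,w_d)^{\rm T}$, ${}^{C}D^{\hat\alpha}_{0^+}w(t)=({}^{C}D^{\alpha_1}_{0^+}w_1(t),\dots,{}^{C}D^{\alpha_d}_{0^+}w_d(t))^{\rm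 T}$. The Mittag-Leffler function is $E_\beta(x)=\sum_{k=0}^\infty \frac{x^k}{\Gamma(\beta k+1)}$, $x\in\mathbb{R}$, $\beta>0$. For each continuous initial function $\varphi$, the system has a unique continuous solution $\Phi(\cdot,\varphi)$ on a maximal interval of existence $[0,T_{\max}(\varphi))$ (extended by $\varphi$ on $[-r,0]$). The trivial solution is the zero solution. *)

theory Defs
  imports "HOL-Analysis.Analysis"
begin

text \<open>The library order \<open>\<le>\<close> on \<open>real ^ 'd\<close> is the componentwise one. Its strict part \<open><\<close> is
  \<^emph>\<open>not\<close> strict in every component, hence the separate relation \<open>\<prec>\<close>.\<close>

definition vec_strict_less :: "real ^ 'd \<Rightarrow> real ^ 'd \<Rightarrow> bool"  (infix "\<prec>" 50)
  where "u \<prec> w \<longleftrightarrow> (\<forall>i. u $ i < w $ i)"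

definition nonneg_orthant :: "(real ^ 'd) set"
  where "nonneg_orthant = {x. 0 \<le> x}"

definition metzler :: "real ^ 'd ^ 'd \<Rightarrow> bool"
  where "metzler A \<longleftrightarrow> (\<forall>i j. i \<noteq> j \<longrightarrow> 0 \<le> A $ i $ j)"

definition continuously_differentiable_on ::
  "(real ^ 'd \<Rightarrow> real ^ 'd) \<Rightarrow> (real ^ 'd) set \<Rightarrow> bool"
  where "continuously_differentiable_on h S \<longleftrightarrow>
    (\<forall>x\<in>S. h differentiable (at x)) \<and> continuous_on S (\<lambda>x. jacobian h (at x))"

definition cooperative :: "(real ^ 'd \<Rightarrow> real ^ 'd) \<Rightarrow> bool"
  where "cooperative f \<longleftrightarrow>
    continuous_on UNIV f \<and>
    continuously_differentiable_on f (UNIV - {0}) \<and>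
    (\<forall>x \<in> nonneg_orthant - {0}. metzler (jacobian f (at x)))"

definition homogeneous :: "real \<Rightarrow> (real ^ 'd \<Rightarrow> real ^ 'd) \<Rightarrow> bool"
  where "homogeneous p h \<longleftrightarrow> (\<forall>x. \<forall>l>0. h (l *\<^sub>R x) = (l powr p) *\<^sub>R h x)"

definition order_preserving :: "(real ^ 'd \<Rightarrow> real ^ 'd) \<Rightarrow> bool"
  where "order_preserving h \<longleftrightarrow> mono_on nonneg_orthant h"

definition frac_integral :: "real \<Rightarrow> (real \<Rightarrow> real) \<Rightarrow> real \<Rightarrow> real"
  where "frac_integral a x t =
    (if a = 0 then x t
     else 1 / Gamma a * (LBINT s:{0..t}. (t - s) powr (a - 1) * x s))"

text \<open>Relational, so that existence of the Caputo derivative is part of the assertion.\<close>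

definition has_caputo_derivative ::
  "real \<Rightarrow> (real \<Rightarrow> real) \<Rightarrow> real \<Rightarrow> real \<Rightarrow> bool"
  where "has_caputo_derivative a x D t \<longleftrightarrow>
    (frac_integral (1 - a) (\<lambda>s. x s - x 0) has_real_derivative D) (at t)"

definition has_caputo_derivative_vec ::
  "real ^ 'd \<Rightarrow> (real \<Rightarrow> real ^ 'd) \<Rightarrow> real ^ 'd \<Rightarrow> real \<Rightarrow> bool"
  where "has_caputo_derivative_vec \<alpha> w D t \<longleftrightarrow>
    (\<forall>i. has_caputo_derivative (\<alpha> $ i) (\<lambda>s. w s $ i) (D $ i) t)"

definition mittag_leffler :: "real \<Rightarrow> real \<Rightarrow> real"
  where "mittag_leffler b x = (\<Sum>k. x ^ k / Gamma (b * real k + 1))"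

text \<open>\<open>w\<close> is a continuous solution on \<open>[0, T)\<close>, extended by \<open>\<phi>\<close> on \<open>[-\<rho>, 0]\<close>; here \<open>T\<close> may be
  \<open>\<infinity>\<close>. The values of \<open>w\<close> outside \<open>[-\<rho>, T)\<close> are irrelevant.\<close>

definition is_solution ::
  "real ^ 'd \<Rightarrow> (real ^ 'd \<Rightarrow> real ^ 'd) \<Rightarrow> nat \<Rightarrow> (nat \<Rightarrow> real ^ 'd \<Rightarrow> real ^ 'd) \<Rightarrow>
   (nat \<Rightarrow> real \<Rightarrow> real) \<Rightarrow> real \<Rightarrow> (real \<Rightarrow> real ^ 'd) \<Rightarrow> ereal \<Rightarrow> (real \<Rightarrow> real ^ 'd) \<Rightarrow> bool"
  where "is_solution \<alpha> f m g \<tau> \<rho> \<phi> T w \<longleftrightarrow>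
    0 < T \<and>
    continuous_on {t. - \<rho> \<le> t \<and> ereal t < T} w \<and>
    (\<forall>s\<in>{- \<rho>..0}. w s = \<phi> s) \<and>
    (\<forall>t>0. ereal t < T \<longrightarrow>
       has_caputo_derivative_vec \<alpha> w (f (w t) + (\<Sum>j=1..m. g j (w (t - \<tau> j t)))) t)"

text \<open>\<open>w\<close> is the solution \<open>\<Phi>(\<cdot>, \<phi>)\<close> and \<open>[0, T)\<close> its maximal interval of existence: every
  solution lives on a subinterval of \<open>[0, T)\<close> and coincides with \<open>w\<close> there.\<close>

definition is_maximal_solution ::
  "real ^ 'd \<Rightarrow> (real ^ 'd \<Rightarrow> real ^ 'd) \<Rightarrow> nat \<Rightarrow> (nat \<Rightarrow> real ^ 'd \<Rightarrow> real ^ 'd) \<Rightarrow>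
   (nat \<Rightarrow> real \<Rightarrow> real) \<Rightarrow> real \<Rightarrow> (real \<Rightarrow> real ^ 'd) \<Rightarrow> ereal \<Rightarrow> (real \<Rightarrow> real ^ 'd) \<Rightarrow> bool"
  where "is_maximal_solution \<alpha> f m g \<tau> \<rho> \<phi> T w \<longleftrightarrow>
    is_solution \<alpha> f m g \<tau> \<rho> \<phi> T w \<and>
    (\<forall>T' w'. is_solution \<alpha> f m g \<tau> \<rho> \<phi> T' w' \<longrightarrow>
       T' \<le> T \<and> (\<forall>t\<ge>- \<rho>. ereal t < T' \<longrightarrow> w' t = w t))"

end

theory Submission imports Defs begin

text \<open>A Caputo equation with continuous right hand side \<open>F\<close> is equivalent to the Volterra equation
\<open>x = x(0) + I\<^sup>\<alpha> F\<close>, where \<open>I\<^sup>\<alpha>\<close> is the Riemann--Liouville integral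
(\<open>caputo_imp_volterra\<close>, \<open>volterra_imp_caputo\<close>). Everything happens on the Volterra side, and one
scalar fact carries the argument, the weak maximum principle \<open>volterra_weak_maximum_principle\<close>: if
\<open>z = z\<^sub>0 + I\<^sup>\<alpha> F\<close> with \<open>z\<^sub>0 \<ge> 0\<close>, and \<open>F \<ge> 0\<close> at each time at which \<open>z < 0\<close>, then \<open>z \<ge> 0\<close>. For orders
below 1, the memory term forces \<open>F\<close> to be strictly negative at a negative minimum of \<open>z\<close>.

The vector \<open>v\<close> yields a decaying supersolution. Put \<open>w(t) = (1 + t/K) powr (- \<beta>)\<close> with
\<open>\<beta> = min\<^sub>i \<alpha>\<^sub>i / (2p)\<close>. In the right hand side along \<open>w v\<close> the delays cost a factor
\<open>(1 + \<rho>/K) powr (\<beta> p)\<close>, which is close to 1 for large \<open>K\<close>, and the degrees \<open>q\<^sub>j \<ge> p\<close> may be replaced by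
\<open>p\<close> because \<open>w \<le> 1\<close>. By homogeneity, the right hand side is therefore at most \<open>- \<kappa> w\<^sup>p\<close> with some \<open>\<kappa> > 0\<close>
independent of \<open>K\<close>. On the other side, the Caputo derivative of order \<open>\<alpha>\<^sub>i\<close> of \<open>w\<close> is at least
\<open>- C (K + t) powr (- \<alpha>\<^sub>i)\<close>, hence at least \<open>- C K powr (- \<alpha>\<^sub>i) w\<^sup>p\<close> because \<open>\<beta> p \<le> \<alpha>\<^sub>i\<close>. So \<open>w v\<close> is a
supersolution for large \<open>K\<close> (\<open>supersolution_exists\<close>).

Existence and the comparison are obtained together (\<open>solution_below_supersolution\<close>): truncate the
arguments of the vector fields to the order interval between \<open>0\<close> and \<open>w v\<close>. Homogeneity of degree at
least 1 makes the fields Lipschitz on balls, also across the origin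
(\<open>homogeneous_lipschitz_on_ball\<close>), so the truncated system is globally Lipschitz and a contraction
in an exponentially weighted norm gives a global solution. The truncation decouples the comparison:
where a component leaves the interval, quasimonotonicity of \<open>f\<close> and monotonicity of the \<open>g\<^sub>j\<close> give the
sign that the scalar maximum principle needs. Hence the solution stays in the interval and solves
the original system. Uniqueness is the usual weighted-norm argument (\<open>solutions_agree\<close>).

Finally \<open>w\<close> is dominated by a Mittag-Leffler function: \<open>E\<^sub>\<beta>(- c t\<^sup>\<beta>) \<ge> w(t)/2\<close> for small \<open>c\<close>
(\<open>mittag_leffler_ge_decay_profile\<close>), once more by the maximum principle. All initial functions with
values in \<open>[0, v]\<close> are admissible, which determines \<open>\<delta>\<close>.\<close>

section \<open>The Riemann--Liouville integral\<close>

text \<open>The kernel is set to zero for nonpositive arguments, so that a Riemann--Liouville integral is a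
convolution over the whole real line and Fubini applies without moving limits of integration.\<close>

definition rl_kernel :: "real \<Rightarrow> real \<Rightarrow> real"
  where "rl_kernel a u = (if 0 < u then u powr (a - 1) / Gamma a else 0)"

definition rl_integral :: "real \<Rightarrow> (real \<Rightarrow> real) \<Rightarrow> real \<Rightarrow> real"
  where "rl_integral a F t = (LINT s|lborel. rl_kernel a (t - s) * (indicator {0..} s * F s))"

lemma rl_kernel_measurable [measurable]: "rl_kernel a \<in> borel_measurable borel"
  unfolding rl_kernel_def by measurable

lemma rl_kernel_nonneg: "0 < a \<Longrightarrow> 0 \<le> rl_kernel a u"
  unfolding rl_kernel_def by (auto intro!: divide_nonneg_pos Gamma_real_pos)

lemma rl_kernel_one: "rl_kernel 1 u = indicator {0<..} u"
  unfolding rl_kernel_def by (auto simp: indicator_def)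

text \<open>This is Euler's Beta integral after the affine substitution that maps \<open>[r, t]\<close> to \<open>[0, 1]\<close>. The
semigroup law and all masses of the kernel are instances.\<close>

lemma rl_kernel_convolution:
  assumes a: "0 < a" and b: "0 < b"
  shows "has_bochner_integral lborel (\<lambda>s. rl_kernel a (t - s) * rl_kernel b (s - r)) (rl_kernel (a + b) (t - r))"
proof (cases "r < t")
  case False
  then have "(\<lambda>s. rl_kernel a (t - s) * rl_kernel b (s - r)) = (\<lambda>_. 0)" "rl_kernel (a + b) (t - r) = 0"
    by (auto simp: rl_kernel_def)
  then show ?thesis by (simp only: has_bochner_integral_zero)
next
  case True
  define c where "c = t - r"
  have c: "c > 0" using True by (simp add: c_def)
  define \<beta> where "\<beta> = (\<lambda>x::real. indicator {0..1} x * (x powr (b - 1) * (1 - x) powr (a - 1)))"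
  have int: "integrable lborel \<beta>"
    using integrable_Beta[OF b a] unfolding set_integrable_def \<beta>_def by simp
  have "(LBINT x:{0..1}. x powr (b - 1) * (1 - x) powr (a - 1)) = Beta b a"
    using set_borel_integral_eq_integral(2)[OF integrable_Beta[OF b a]] has_integral_Beta_real[OF b a]
    by (simp add: integral_unique)
  then have "has_bochner_integral lborel \<beta> (Beta b a)"
    using int unfolding has_bochner_integral_iff set_lebesgue_integral_def \<beta>_def by simp
  then have "has_bochner_integral lborel (\<lambda>x. \<beta> (- r / c + (1 / c) * x)) (Beta b a /\<^sub>R \<bar>1 / c\<bar>)"
    using c by (subst lborel_has_bochner_integral_real_affine_iff[symmetric]) auto
  then have *: "has_bochner_integral lborel (\<lambda>x. (c powr (a + b - 2) / (Gamma a * Gamma b)) * \<beta> (- r / c + (1 / c) * x))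
      ((c powr (a + b - 2) / (Gamma a * Gamma b)) * (Beta b a /\<^sub>R \<bar>1 / c\<bar>))"
    by (rule has_bochner_integral_mult_right)
  have "(c powr (a + b - 2) / (Gamma a * Gamma b)) * (Beta b a /\<^sub>R \<bar>1 / c\<bar>) = rl_kernel (a + b) (t - r)"
  proof -
    have "c powr (a + b - 2) * c = c powr (a + b - 1)"
      using c powr_mult_base[of c "a + b - 2"] by (simp add: mult.commute algebra_simps)
    then have "c powr (a + b - 2) * c * (Gamma b * Gamma a / Gamma (b + a)) / (Gamma a * Gamma b)
      = c powr (a + b - 1) / Gamma (a + b)"
      using Gamma_real_pos[OF a] Gamma_real_pos[OF b] by (simp add: add.commute)
    then show ?thesis
      using c unfolding rl_kernel_def Beta_def by (simp add: c_def[symmetric] mult.commute mult.left_commute)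
  qed
  moreover have "(c powr (a + b - 2) / (Gamma a * Gamma b)) * \<beta> (- r / c + (1 / c) * s)
      = rl_kernel a (t - s) * rl_kernel b (s - r)" for s
  proof -
    have eq: "- r / c + (1 / c) * s = (s - r) / c" using c by (simp add: field_simps)
    have eq2: "1 - (s - r) / c = (t - s) / c" using c by (simp add: field_simps c_def)
    consider "s \<le> r" | "t \<le> s" | "r < s" "s < t" by linarith
    then show ?thesis
    proof cases
      case 1
      then have "(s - r) / c < 0 \<or> (s - r) / c = 0" using c by (auto simp: divide_less_0_iff)
      then show ?thesis using 1 unfolding eq \<beta>_def by (auto simp: rl_kernel_def)
    next
      case 2
      then have "(s - r) / c > 1 \<or> (s - r) / c = 1" using c by (auto simp: c_def)
      then show ?thesis using 2 unfolding eq \<beta>_def by (auto simp: rl_kernel_def)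
    next
      case 3
      have e1: "c powr (a + b - 2) = c powr (a - 1) * c powr (b - 1)"
        by (simp add: powr_add[symmetric])
      have e2: "c powr (a - 1) * ((t - s) / c) powr (a - 1) = (t - s) powr (a - 1)"
        using 3 c by (simp add: powr_divide)
      have e3: "c powr (b - 1) * ((s - r) / c) powr (b - 1) = (s - r) powr (b - 1)"
        using 3 c by (simp add: powr_divide)
      have e4: "(s - r) / c \<in> {0..1}" using 3 c by (auto simp: c_def)
      have "(c powr (a + b - 2) / (Gamma a * Gamma b)) * (((s - r) / c) powr (b - 1) * ((t - s) / c) powr (a - 1))
          = (c powr (a - 1) * ((t - s) / c) powr (a - 1) / Gamma a) * (c powr (b - 1) * ((s - r) / c) powr (b - 1) / Gamma b)"
        unfolding e1 by simp
      also have "\<dots> = rl_kernel a (t - s) * rl_kernel b (s - r)"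
        unfolding e2 e3 using 3 by (simp add: rl_kernel_def)
      finally show ?thesis using e4 unfolding eq \<beta>_def eq2 by simp
    qed
  qed
  ultimately show ?thesis using * by simp
qed

lemma rl_kernel_mass:
  assumes a: "0 < a"
  shows "has_bochner_integral lborel (\<lambda>s. rl_kernel a (t - s) * indicator {c..} s) ((max 0 (t - c)) powr a / Gamma (a + 1))"
proof -
  have "has_bochner_integral lborel (\<lambda>s. rl_kernel a (t - s) * rl_kernel 1 (s - c)) (rl_kernel (a + 1) (t - c))"
    by (rule rl_kernel_convolution) (use a in auto)
  moreover have "rl_kernel (a + 1) (t - c) = (max 0 (t - c)) powr a / Gamma (a + 1)"
    using a by (auto simp: rl_kernel_def max_def)
  moreover have "has_bochner_integral lborel (\<lambda>s. rl_kernel a (t - s) * rl_kernel 1 (s - c)) y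
     \<longleftrightarrow> has_bochner_integral lborel (\<lambda>s. rl_kernel a (t - s) * indicator {c..} s) y" for y
    by (rule has_bochner_integral_cong_AE)
       (use AE_lborel_singleton[of c] in \<open>auto simp: rl_kernel_one indicator_def\<close>)
  ultimately show ?thesis by simp
qed

lemma rl_integrable:
  assumes a: "0 < a" and [measurable]: "F \<in> borel_measurable borel" and M: "\<And>s. \<bar>F s\<bar> \<le> M"
  shows "integrable lborel (\<lambda>s. rl_kernel a (t - s) * (indicator {0..} s * F s))"
proof (rule Bochner_Integration.integrable_bound)
  show "integrable lborel (\<lambda>s. M * (rl_kernel a (t - s) * indicator {0..} s))"
    using rl_kernel_mass[OF a, of t 0] by (simp add: has_bochner_integral_iff)
  show "AE s in lborel. norm (rl_kernel a (t - s) * (indicator {0..} s * F s)) \<le> norm (M * (rl_kernel a (t - s) * indicator {0..} s))"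
  proof (rule AE_I2)
    fix s
    have "\<bar>F s\<bar> * rl_kernel a (t - s) \<le> \<bar>M\<bar> * rl_kernel a (t - s)"
      using M[of s] rl_kernel_nonneg[OF a] by (intro mult_right_mono) auto
    then show "norm (rl_kernel a (t - s) * (indicator {0..} s * F s)) \<le> norm (M * (rl_kernel a (t - s) * indicator {0..} s))"
      using rl_kernel_nonneg[OF a, of "t - s"] by (auto simp: indicator_def abs_mult mult.commute)
  qed
qed simp

lemma rl_integral_cong:
  assumes "\<And>s. 0 \<le> s \<Longrightarrow> s < t \<Longrightarrow> F s = G s"
  shows "rl_integral a F t = rl_integral a G t"
  unfolding rl_integral_def
  by (rule Bochner_Integration.integral_cong) (use assms in \<open>auto simp: rl_kernel_def indicator_def\<close>)

lemma rl_integral_nonpos_time: "t \<le> 0 \<Longrightarrow> rl_integral a F t = 0"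
  unfolding rl_integral_def
  by (rule integral_eq_zero_AE) (auto simp: rl_kernel_def indicator_def)

lemma frac_integral_eq_rl_integral:
  assumes "a \<noteq> 0"
  shows "frac_integral a x t = rl_integral a x t"
proof -
  have "frac_integral a x t = (LINT s|lborel. 1 / Gamma a * (indicat_real {0..t} s *\<^sub>R ((t - s) powr (a - 1) * x s)))"
    using assms unfolding frac_integral_def set_lebesgue_integral_def by simp
  also have "\<dots> = rl_integral a x t"
    unfolding rl_integral_def
    by (rule Bochner_Integration.integral_cong) (auto simp: rl_kernel_def indicator_def)
  finally show ?thesis .
qed

text \<open>Only the values on \<open>[0, t]\<close> matter for the integral up to \<open>t\<close>, and a continuous function cut off
outside a compact interval is bounded and measurable. This class therefore serves all later
purposes, and it admits pieces that jump.\<close>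

definition bounded_borel :: "(real \<Rightarrow> real) \<Rightarrow> bool"
  where "bounded_borel F \<longleftrightarrow> F \<in> borel_measurable borel \<and> (\<exists>M. \<forall>s. \<bar>F s\<bar> \<le> M)"

lemma bounded_borelE:
  assumes "bounded_borel F"
  obtains M where "F \<in> borel_measurable borel" "0 \<le> M" "\<And>s. \<bar>F s\<bar> \<le> M"
proof -
  from assms obtain M where "F \<in> borel_measurable borel" "\<And>s. \<bar>F s\<bar> \<le> M"
    unfolding bounded_borel_def by blast
  moreover from this(2)[of 0] have "0 \<le> M" by linarith
  ultimately show thesis using that by blast
qed

lemma bounded_borel_integrable:
  "0 < a \<Longrightarrow> bounded_borel F \<Longrightarrow> integrable lborel (\<lambda>s. rl_kernel a (t - s) * (indicator {0..} s * F s))"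
  by (erule bounded_borelE, rule rl_integrable) auto

lemma bounded_borel_add: "bounded_borel F \<Longrightarrow> bounded_borel G \<Longrightarrow> bounded_borel (\<lambda>s. F s + G s)"
  unfolding bounded_borel_def
  by (auto, metis abs_triangle_ineq add_mono order_trans)

lemma bounded_borel_cmult: "bounded_borel F \<Longrightarrow> bounded_borel (\<lambda>s. c * F s)"
  unfolding bounded_borel_def
  by (auto simp: abs_mult, metis abs_ge_zero mult_left_mono)

lemma bounded_borel_diff: "bounded_borel F \<Longrightarrow> bounded_borel G \<Longrightarrow> bounded_borel (\<lambda>s. F s - G s)"
  using bounded_borel_add[of F "\<lambda>s. (- 1) * G s"] bounded_borel_cmult[of G "- 1"] by simp

lemma bounded_borel_const: "bounded_borel (\<lambda>s. c)"
  unfolding bounded_borel_def by auto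

lemma bounded_borel_indicator: "A \<in> sets borel \<Longrightarrow> bounded_borel F \<Longrightarrow> bounded_borel (\<lambda>s. indicator A s * F s)"
  unfolding bounded_borel_def
  by (auto simp: indicator_def) (metis abs_ge_zero abs_zero mult_cancel_right2 mult_zero_left order_trans)

lemma bounded_borel_continuous:
  assumes "continuous_on {0..T} F"
  shows "bounded_borel (\<lambda>s. indicator {0..T} s * F s)"
proof -
  have "compact (F ` {0..T})" using assms by (intro compact_continuous_image) auto
  then obtain M where "\<forall>y\<in>F ` {0..T}. norm y \<le> M"
    using compact_imp_bounded bounded_iff by blast
  then have "\<forall>s. \<bar>indicator {0..T} s * F s\<bar> \<le> max 0 M" by (auto simp: indicator_def le_max_iff_disj)
  moreover have "(\<lambda>s. indicator {0..T} s * F s) \<in> borel_measurable borel"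
    using borel_measurable_continuous_on_indicator[of "{0..T}" F] assms by simp
  ultimately show ?thesis unfolding bounded_borel_def by blast
qed

lemma rl_integral_cutoff: "t \<le> T \<Longrightarrow> rl_integral a (\<lambda>s. indicator {0..T} s * F s) t = rl_integral a F t"
  by (rule rl_integral_cong) auto

lemma rl_integral_add:
  "0 < a \<Longrightarrow> bounded_borel F \<Longrightarrow> bounded_borel G \<Longrightarrow>
   rl_integral a (\<lambda>s. F s + G s) t = rl_integral a F t + rl_integral a G t"
  unfolding rl_integral_def
  by (subst Bochner_Integration.integral_add[symmetric])
     (blast intro: bounded_borel_integrable | simp add: distrib_left)+

lemma rl_integral_cmult: "rl_integral a (\<lambda>s. c * F s) t = c * rl_integral a F t"
  unfolding rl_integral_def by (simp add: mult.left_commute)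

lemma rl_integral_diff:
  "0 < a \<Longrightarrow> bounded_borel F \<Longrightarrow> bounded_borel G \<Longrightarrow>
   rl_integral a (\<lambda>s. F s - G s) t = rl_integral a F t - rl_integral a G t"
  using rl_integral_add[of a F "\<lambda>s. (- 1) * G s" t] bounded_borel_cmult[of G "- 1"] rl_integral_cmult[of a "- 1" G t]
  by simp

lemma rl_integral_const:
  "0 < a \<Longrightarrow> 0 \<le> t \<Longrightarrow> rl_integral a (\<lambda>_. c) t = c * t powr a / Gamma (a + 1)"
  using rl_kernel_mass[of a t 0] rl_integral_cmult[of a c "\<lambda>_. 1" t] unfolding rl_integral_def
  by (simp add: has_bochner_integral_iff)

lemma rl_integral_semigroup:
  assumes a: "0 < a" and b: "0 < b" and F: "bounded_borel F"
  shows "rl_integral a (rl_integral b F) t = rl_integral (a + b) F t"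
proof -
  obtain M where [measurable]: "F \<in> borel_measurable borel" and M: "\<And>s. \<bar>F s\<bar> \<le> M"
    using bounded_borelE[OF F] by blast
  define K where "K = (\<lambda>(r, s). rl_kernel a (t - s) * rl_kernel b (s - r) * (indicator {0..} r * F r))"
  have [measurable]: "K \<in> borel_measurable (lborel \<Otimes>\<^sub>M lborel)" unfolding K_def by measurable
  have inner: "has_bochner_integral lborel (\<lambda>s. c * (rl_kernel a (t - s) * rl_kernel b (s - r)))
     (c * rl_kernel (a + b) (t - r))" for r c
    by (rule has_bochner_integral_mult_right) (rule rl_kernel_convolution[OF a b])
  have Kint: "integrable (lborel \<Otimes>\<^sub>M lborel) K"
  proof (rule lborel_pair.Fubini_integrable)
    have "(\<integral>s. norm (K (r, s)) \<partial>lborel) = rl_kernel (a + b) (t - r) * (indicator {0..} r * \<bar>F r\<bar>)" for r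
    proof -
      have "norm (K (r, s)) = (indicator {0..} r * \<bar>F r\<bar>) * (rl_kernel a (t - s) * rl_kernel b (s - r))" for s
        using rl_kernel_nonneg[OF a, of "t - s"] rl_kernel_nonneg[OF b, of "s - r"] by (simp add: K_def abs_mult)
      then show ?thesis using inner[of "indicator {0..} r * \<bar>F r\<bar>" r]
        by (simp add: has_bochner_integral_iff mult.commute)
    qed
    then show "integrable lborel (\<lambda>r. \<integral>s. norm (K (r, s)) \<partial>lborel)"
      using rl_integrable[of "a + b" "\<lambda>r. \<bar>F r\<bar>" M t] a b M by simp
    show "AE r in lborel. integrable lborel (\<lambda>s. K (r, s))"
    proof (rule AE_I2)
      fix r show "integrable lborel (\<lambda>s. K (r, s))"
        using inner[of "indicator {0..} r * F r" r] by (simp add: K_def has_bochner_integral_iff ac_simps)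
    qed
  qed simp
  have "(\<integral>s. (\<integral>r. K (r, s) \<partial>lborel) \<partial>lborel) = (\<integral>r. (\<integral>s. K (r, s) \<partial>lborel) \<partial>lborel)"
    by (rule lborel_pair.Fubini_integral[of "\<lambda>r s. K (r, s)"]) (use Kint in simp)
  moreover have "(\<integral>r. K (r, s) \<partial>lborel) = rl_kernel a (t - s) * (indicator {0..} s * rl_integral b F s)" for s
  proof (cases "0 \<le> s")
    case True
    then show ?thesis unfolding rl_integral_def K_def by (simp add: mult.assoc)
  next
    case False
    then have "(\<lambda>r. K (r, s)) = (\<lambda>r. 0)"
      by (auto simp: K_def rl_kernel_def indicator_def fun_eq_iff)
    then show ?thesis using False by simp
  qed
  moreover have "(\<integral>s. K (r, s) \<partial>lborel) = rl_kernel (a + b) (t - r) * (indicator {0..} r * F r)" for r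
    using inner[of "indicator {0..} r * F r" r]
    by (simp add: K_def has_bochner_integral_iff ac_simps)
  ultimately show ?thesis unfolding rl_integral_def by simp
qed

section \<open>Regularity of the Riemann--Liouville integral\<close>

text \<open>For orders up to 1 the weight of a past value decreases as time goes on. The Hoelder estimates and
the maximum principle rest on this.\<close>

lemma rl_kernel_antimono: "0 < a \<Longrightarrow> a \<le> 1 \<Longrightarrow> 0 < u \<Longrightarrow> u \<le> v \<Longrightarrow> rl_kernel a v \<le> rl_kernel a u"
  unfolding rl_kernel_def
  by (auto intro!: divide_right_mono powr_mono2' less_imp_le[OF Gamma_real_pos])

text \<open>Moving the endpoint from \<open>t'\<close> to \<open>t\<close> lowers the weight of the past \<open>[0, t']\<close> and adds the mass on
\<open>[t', t]\<close>. The total mass does not decrease, so the loss is at most the gain, which is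
\<open>(t - t')\<close> to the power \<open>a\<close> over \<open>\<Gamma>(a + 1)\<close>.\<close>

lemma rl_integral_holder:
  assumes a: "0 < a" "a \<le> 1" and [measurable]: "F \<in> borel_measurable borel"
    and M: "\<And>s. \<bar>F s\<bar> \<le> M" and t: "0 \<le> t'" "t' \<le> t"
  shows "\<bar>rl_integral a F t - rl_integral a F t'\<bar> \<le> 2 * M * (t - t') powr a / Gamma (a + 1)"
proof -
  let ?f = "\<lambda>s. rl_kernel a (t - s) * (indicator {0..} s * F s) - rl_kernel a (t' - s) * (indicator {0..} s * F s)"
  let ?g = "\<lambda>s. M * (rl_kernel a (t' - s) * indicator {0..} s - rl_kernel a (t - s) * indicator {0..} s
      + 2 * (rl_kernel a (t - s) * indicator {t'..} s))"
  have f: "has_bochner_integral lborel ?f (rl_integral a F t - rl_integral a F t')"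
    unfolding rl_integral_def
    by (intro has_bochner_integral_diff has_bochner_integral_integrable rl_integrable[where M=M]) (use a M in auto)
  have g: "has_bochner_integral lborel ?g (M * ((max 0 (t' - 0)) powr a / Gamma (a + 1)
    - (max 0 (t - 0)) powr a / Gamma (a + 1) + 2 * ((max 0 (t - t')) powr a / Gamma (a + 1))))"
    by (intro has_bochner_integral_mult_right has_bochner_integral_diff has_bochner_integral_add rl_kernel_mass a)
  have le: "norm (?f s) \<le> ?g s" for s
  proof -
    have M0: "0 \<le> M" using M[of s] by linarith
    note k = rl_kernel_nonneg[OF a(1), of "t - s"] rl_kernel_nonneg[OF a(1), of "t' - s"]
    consider "s < 0" | "0 \<le> s" "s < t'" | "0 \<le> s" "t' \<le> s" by linarith
    then show ?thesis
    proof cases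
      case 1
      then show ?thesis using t by simp
    next
      case 2
      have "rl_kernel a (t - s) \<le> rl_kernel a (t' - s)" using 2 t a by (intro rl_kernel_antimono) auto
      then have "\<bar>(rl_kernel a (t - s) - rl_kernel a (t' - s)) * F s\<bar> \<le> (rl_kernel a (t' - s) - rl_kernel a (t - s)) * M"
        unfolding abs_mult using M[of s] by (intro mult_mono) auto
      then show ?thesis using 2 by (simp add: algebra_simps)
    next
      case 3
      have "\<bar>rl_kernel a (t - s) * F s\<bar> \<le> rl_kernel a (t - s) * M"
        unfolding abs_mult using M[of s] k by (intro mult_mono) auto
      then show ?thesis using 3 by (simp add: algebra_simps rl_kernel_def)
    qed
  qed
  have "\<bar>rl_integral a F t - rl_integral a F t'\<bar> \<le> (\<integral>s. norm (?f s) \<partial>lborel)"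
    using f integral_norm_bound[of lborel ?f] by (simp add: has_bochner_integral_iff)
  also have "\<dots> \<le> (\<integral>s. ?g s \<partial>lborel)"
    by (rule integral_mono) (use f g le in \<open>auto simp: has_bochner_integral_iff\<close>)
  also have "\<dots> = M * (t' powr a - t powr a + 2 * (t - t') powr a) / Gamma (a + 1)"
    by (rule trans[OF has_bochner_integral_integral_eq[OF g]])
       (use t in \<open>simp add: add_divide_distrib diff_divide_distrib distrib_left right_diff_distrib\<close>)
  also have "\<dots> \<le> M * (2 * (t - t') powr a) / Gamma (a + 1)"
    using M[of 0] t a Gamma_real_pos[of "a + 1"]
    by (intro divide_right_mono mult_left_mono) (auto intro!: powr_mono2)
  finally show ?thesis by (simp add: ac_simps)
qed

text \<open>For nonnegative \<open>F\<close> the past only loses weight, so an increase comes from the last stretch alone.\<close>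

lemma rl_integral_increment_le:
  assumes a: "0 < a" "a \<le> 1" and F: "bounded_borel F"
    and nonneg: "\<And>s. 0 \<le> s \<Longrightarrow> s < t \<Longrightarrow> 0 \<le> F s" and e: "\<And>s. t' \<le> s \<Longrightarrow> s < t \<Longrightarrow> F s \<le> e"
    and t: "0 \<le> t'" "t' \<le> t"
  shows "rl_integral a F t - rl_integral a F t' \<le> e * (t - t') powr a / Gamma (a + 1)"
proof -
  let ?f = "\<lambda>s. rl_kernel a (t - s) * (indicator {0..} s * F s) - rl_kernel a (t' - s) * (indicator {0..} s * F s)"
  let ?g = "\<lambda>s. e * (rl_kernel a (t - s) * indicator {t'..} s)"
  have f: "has_bochner_integral lborel ?f (rl_integral a F t - rl_integral a F t')"
    unfolding rl_integral_def
    by (intro has_bochner_integral_diff has_bochner_integral_integrable bounded_borel_integrable a F)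
  have g: "has_bochner_integral lborel ?g (e * ((max 0 (t - t')) powr a / Gamma (a + 1)))"
    by (intro has_bochner_integral_mult_right rl_kernel_mass a)
  have le: "?f s \<le> ?g s" for s
  proof -
    note k = rl_kernel_nonneg[OF a(1), of "t - s"]
    consider "s < 0" | "0 \<le> s" "s < t'" | "t' \<le> s" "s < t" | "t \<le> s" by linarith
    then show ?thesis
    proof cases
      case 2
      have "rl_kernel a (t - s) \<le> rl_kernel a (t' - s)" using 2 t a by (intro rl_kernel_antimono) auto
      then have "rl_kernel a (t - s) * F s \<le> rl_kernel a (t' - s) * F s"
        using nonneg[of s] 2 t by (intro mult_right_mono) auto
      then show ?thesis using 2 by simp
    next
      case 3
      then have "rl_kernel a (t - s) * F s \<le> rl_kernel a (t - s) * e"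
        using e k by (intro mult_left_mono) auto
      then show ?thesis using 3 t by (simp add: rl_kernel_def ac_simps)
    qed (use t in \<open>auto simp: rl_kernel_def\<close>)
  qed
  have "rl_integral a F t - rl_integral a F t' \<le> (\<integral>s. ?g s \<partial>lborel)"
    using f g le integral_mono[of lborel ?f ?g] by (simp add: has_bochner_integral_iff)
  also have "\<dots> = e * (t - t') powr a / Gamma (a + 1)"
    using g t by (simp add: has_bochner_integral_iff)
  finally show ?thesis .
qed

lemma continuous_on_rl_integral_bounded:
  assumes a: "0 < a" "a \<le> 1" and F: "bounded_borel F"
  shows "continuous_on UNIV (rl_integral a F)"
proof -
  obtain M where M: "F \<in> borel_measurable borel" "0 \<le> M" "\<And>s. \<bar>F s\<bar> \<le> M"
    using bounded_borelE[OF F] by blast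
  define C where "C = 2 * M / Gamma (a + 1)"
  have half: "\<bar>rl_integral a F x - rl_integral a F y\<bar> \<le> C * \<bar>x - y\<bar> powr a" if "x \<le> y" for x y
  proof -
    have C: "0 \<le> C" using M(2) Gamma_real_pos[of "a + 1"] a by (simp add: C_def)
    have "\<bar>rl_integral a F (max 0 y) - rl_integral a F (max 0 x)\<bar> \<le> C * (max 0 y - max 0 x) powr a"
      using rl_integral_holder[OF a M(1,3), of "max 0 x" "max 0 y"] that by (simp add: C_def)
    also have "\<dots> \<le> C * \<bar>x - y\<bar> powr a"
      using C that a by (intro mult_left_mono powr_mono2) auto
    finally show ?thesis by (simp add: max_def rl_integral_nonpos_time abs_minus_commute split: if_splits)
  qed
  have *: "\<bar>rl_integral a F x - rl_integral a F y\<bar> \<le> C * \<bar>x - y\<bar> powr a" for x y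
    using half[of x y] half[of y x] by (cases "x \<le> y") (auto simp: abs_minus_commute)
  show ?thesis
    unfolding continuous_on_eq_continuous_at[OF open_UNIV] isCont_def
  proof
    fix x
    have "((\<lambda>y. C * \<bar>y - x\<bar> powr a) \<longlongrightarrow> C * \<bar>x - x\<bar> powr a) (at x)"
      using a by (intro tendsto_intros) auto
    then have "((\<lambda>y. C * \<bar>y - x\<bar> powr a) \<longlongrightarrow> 0) (at x)" by simp
    then have "((\<lambda>y. rl_integral a F y - rl_integral a F x) \<longlongrightarrow> 0) (at x)"
      by (rule Lim_null_comparison[rotated]) (simp add: *)
    then show "(rl_integral a F \<longlongrightarrow> rl_integral a F x) (at x)" by (simp add: LIM_zero_iff)
  qed
qed

lemma continuous_on_rl_integral:
  assumes a: "0 < a" "a \<le> 1" and F: "continuous_on {0..T} F"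
  shows "continuous_on {0..T} (rl_integral a F)"
proof -
  have "continuous_on {0..T} (rl_integral a (\<lambda>s. indicator {0..T} s * F s))"
    using continuous_on_rl_integral_bounded[OF a bounded_borel_continuous[OF F]] continuous_on_subset by blast
  then show ?thesis by (rule continuous_on_eq) (simp add: rl_integral_cutoff)
qed

lemma rl_integral_semigroup_continuous:
  assumes ab: "0 < a" "0 < b" and F: "continuous_on {0..T} F" and t: "t \<le> T"
  shows "rl_integral a (rl_integral b F) t = rl_integral (a + b) F t"
proof -
  have "rl_integral a (rl_integral b F) t = rl_integral a (rl_integral b (\<lambda>s. indicator {0..T} s * F s)) t"
    by (rule rl_integral_cong) (use t in \<open>simp add: rl_integral_cutoff\<close>)
  also have "\<dots> = rl_integral (a + b) (\<lambda>s. indicator {0..T} s * F s) t"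
    by (rule rl_integral_semigroup[OF ab bounded_borel_continuous[OF F]])
  finally show ?thesis using t by (simp add: rl_integral_cutoff)
qed

lemma rl_integral_one:
  assumes F: "continuous_on {0..t} F"
  shows "rl_integral 1 F t = integral {0..t} F"
proof -
  have [measurable]: "(\<lambda>s. indicator {0..t} s * F s) \<in> borel_measurable borel"
    using bounded_borel_continuous[OF F] by (auto simp: bounded_borel_def)
  have "rl_integral 1 F t = (LINT s|lborel. rl_kernel 1 (t - s) * (indicator {0..t} s * F s))"
    unfolding rl_integral_def
    by (rule Bochner_Integration.integral_cong) (auto simp: rl_kernel_def indicator_def)
  also have "\<dots> = (LINT s|lborel. indicator {0..t} s * F s)"
  proof (rule integral_cong_AE)
    show "AE s in lborel. rl_kernel 1 (t - s) * (indicator {0..t} s * F s) = indicator {0..t} s * F s"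
      using AE_lborel_singleton[of t] by eventually_elim (auto simp: rl_kernel_one indicator_def)
  qed measurable
  also have "\<dots> = integral {0..t} F"
    using set_borel_integral_eq_integral(2)[OF borel_integrable_atLeastAtMost'[OF F]]
    by (simp add: set_lebesgue_integral_def)
  finally show ?thesis .
qed

lemma rl_integral_one_deriv:
  assumes F: "continuous_on {0..T} F" and t: "t \<in> {0..T}"
  shows "(rl_integral 1 F has_real_derivative F t) (at t within {0..T})"
proof -
  have "((\<lambda>x. integral {0..x} F) has_real_derivative F t) (at t within {0..T})"
    by (rule integral_has_real_derivative[OF F t])
  then show ?thesis
    by (rule has_field_derivative_transform_within[where d=1])
       (use t F in \<open>auto intro!: rl_integral_one[symmetric] intro: continuous_on_subset\<close>)
qed

section \<open>Caputo equations as Volterra equations\<close>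

text \<open>Integrating the equation gives \<open>I\<^sup>1\<^sup>-\<^sup>a (x - x(0)) = I\<^sup>1 F\<close>. Applying \<open>I\<^sup>a\<close> yields
\<open>I\<^sup>1 (x - x(0)) = I\<^sup>1 (I\<^sup>a F)\<close> by the semigroup law, and both integrands are continuous. The order
\<open>a = 1\<close> is separate because the definition of the fractional integral treats order 0 separately.\<close>

lemma caputo_imp_volterra:
  assumes a: "0 < a" "a \<le> 1" and x: "continuous_on {0..<T} x" and F: "continuous_on {0..<T} F"
    and D: "\<And>t. 0 < t \<Longrightarrow> t < T \<Longrightarrow> has_caputo_derivative a x (F t) t"
    and t: "0 \<le> t" "t < T"
  shows "x t = x 0 + rl_integral a F t"
proof (cases "t = 0")
  case True
  then show ?thesis by (simp add: rl_integral_nonpos_time)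
next
  case False
  obtain S where S: "t < S" "S < T" using t dense by blast
  have xS: "continuous_on {0..S} x" and FS: "continuous_on {0..S} F"
    using x F S by (auto intro: continuous_on_subset)
  define y where "y = (\<lambda>s. x s - x 0)"
  have yS: "continuous_on {0..S} y" using xS unfolding y_def by (intro continuous_intros)
  have FI: "continuous_on {0..S} (rl_integral 1 F)" by (rule continuous_on_rl_integral) (use FS in auto)
  have DF: "(rl_integral 1 F has_real_derivative F s) (at s)" if "0 < s" "s < S" for s
    using rl_integral_one_deriv[OF FS, of s] that at_within_Icc_at[of 0 s S] by auto
  have Gc: "continuous_on {0..S} (frac_integral (1 - a) y)"
  proof (cases "a = 1")
    case True
    then show ?thesis using yS by (simp add: frac_integral_def[abs_def])
  next
    case False
    then have "frac_integral (1 - a) y = rl_integral (1 - a) y"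
      using frac_integral_eq_rl_integral[of "1 - a" y] by auto
    then show ?thesis using continuous_on_rl_integral[OF _ _ yS, of "1 - a"] a False by simp
  qed
  have G0: "frac_integral (1 - a) y 0 = 0"
  proof (cases "a = 1")
    case False
    then show ?thesis using frac_integral_eq_rl_integral[of "1 - a" y 0] by (simp add: rl_integral_nonpos_time)
  qed (simp add: frac_integral_def y_def)
  have G: "frac_integral (1 - a) y u = rl_integral 1 F u" if u: "0 \<le> u" "u \<le> S" for u
  proof (cases "u = 0")
    case True
    then show ?thesis using G0 by (simp add: rl_integral_nonpos_time)
  next
    case False
    have "frac_integral (1 - a) y u - rl_integral 1 F u = frac_integral (1 - a) y 0 - rl_integral 1 F 0"
    proof (rule DERIV_isconst_end[of 0 u "\<lambda>s. frac_integral (1 - a) y s - rl_integral 1 F s"])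
      show "0 < u" using u False by simp
      show "continuous_on {0..u} (\<lambda>s. frac_integral (1 - a) y s - rl_integral 1 F s)"
        using u Gc FI by (intro continuous_intros) (auto intro: continuous_on_subset)
      fix s assume s: "0 < s" "s < u"
      then have "(frac_integral (1 - a) y has_real_derivative F s) (at s)"
        using D[of s] S u unfolding has_caputo_derivative_def y_def by simp
      from DERIV_diff[OF this DF[of s]]
      show "((\<lambda>s. frac_integral (1 - a) y s - rl_integral 1 F s) has_real_derivative 0) (at s)"
        using s u by simp
    qed
    then show ?thesis using G0 by (simp add: rl_integral_nonpos_time)
  qed
  show ?thesis
  proof (cases "a = 1")
    case True
    then show ?thesis using G[of t] t S by (simp add: frac_integral_def y_def)
  next
    case False
    then have a1: "0 < 1 - a" "1 - a \<le> 1" using a by auto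
    have eq: "rl_integral 1 y u = rl_integral 1 (rl_integral a F) u" if u: "0 \<le> u" "u \<le> S" for u
    proof -
      have "rl_integral 1 y u = rl_integral a (rl_integral (1 - a) y) u"
        using rl_integral_semigroup_continuous[OF a(1) a1(1) yS, of u] u by simp
      also have "\<dots> = rl_integral a (rl_integral 1 F) u"
      proof (rule rl_integral_cong)
        fix s assume "0 \<le> s" "s < u"
        then show "rl_integral (1 - a) y s = rl_integral 1 F s"
          using G[of s] frac_integral_eq_rl_integral[of "1 - a" y s] False u by simp
      qed
      also have "\<dots> = rl_integral (a + 1) F u"
        by (rule rl_integral_semigroup_continuous[OF _ _ FS]) (use a u in auto)
      also have "\<dots> = rl_integral (1 + a) F u" by (simp add: add.commute)
      also have "\<dots> = rl_integral 1 (rl_integral a F) u"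
        by (rule rl_integral_semigroup_continuous[OF _ _ FS, symmetric]) (use a u in auto)
      finally show ?thesis .
    qed
    have t': "0 < t" "t < S" using t S False \<open>t \<noteq> 0\<close> by auto
    have "(rl_integral 1 y has_real_derivative y t) (at t within {0..S})"
      by (rule rl_integral_one_deriv[OF yS]) (use t' in auto)
    then have d1: "(rl_integral 1 (rl_integral a F) has_real_derivative y t) (at t within {0..S})"
      by (rule has_field_derivative_transform_within[where d=1]) (use eq t' in auto)
    have d2: "(rl_integral 1 (rl_integral a F) has_real_derivative rl_integral a F t) (at t within {0..S})"
      by (rule rl_integral_one_deriv[OF continuous_on_rl_integral[OF a FS]]) (use t' in auto)
    have "y t = rl_integral a F t"
      using d1 d2 t' at_within_Icc_at[of 0 t S] DERIV_unique by metis
    then show ?thesis by (simp add: y_def)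
  qed
qed

lemma volterra_imp_caputo:
  assumes a: "0 < a" "a \<le> 1" and F: "continuous_on {0..<T} F"
    and x: "\<And>t. 0 \<le> t \<Longrightarrow> t < T \<Longrightarrow> x t = x0 + rl_integral a F t"
    and t: "0 < t" "t < T"
  shows "has_caputo_derivative a x (F t) t"
proof -
  obtain S where S: "t < S" "S < T" using t dense by blast
  have FS: "continuous_on {0..S} F" using F S by (auto intro: continuous_on_subset)
  have x0: "x 0 = x0" using x[of 0] t by (simp add: rl_integral_nonpos_time)
  have eq: "frac_integral (1 - a) (\<lambda>s. x s - x 0) u = rl_integral 1 F u" if u: "u \<in> {0<..<S}" for u
  proof (cases "a = 1")
    case True
    then show ?thesis using u x[of u] S by (simp add: frac_integral_def x0)
  next
    case False
    have "frac_integral (1 - a) (\<lambda>s. x s - x 0) u = rl_integral (1 - a) (\<lambda>s. x s - x 0) u"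
      by (rule frac_integral_eq_rl_integral) (use False in simp)
    also have "\<dots> = rl_integral (1 - a) (rl_integral a F) u"
      by (rule rl_integral_cong) (use x u S x0 in auto)
    also have "\<dots> = rl_integral 1 F u"
      using rl_integral_semigroup_continuous[OF _ a(1) FS, of "1 - a" u] u a False by simp
    finally show ?thesis .
  qed
  have "(rl_integral 1 F has_real_derivative F t) (at t)"
    using rl_integral_one_deriv[OF FS, of t] t S at_within_Icc_at[of 0 t S] by auto
  then show ?thesis unfolding has_caputo_derivative_def
    by (rule has_field_derivative_transform_within_open[where S="{0<..<S}"]) (use t S eq in auto)
qed

section \<open>A weak maximum principle\<close>

lemma powr_lipschitz_away_from_zero:
  fixes p :: real
  assumes "p \<le> 1" "0 < e" "e \<le> u" "u \<le> v"
  shows "\<bar>v powr p - u powr p\<bar> \<le> \<bar>p\<bar> * e powr (p - 1) * (v - u)"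
proof (cases "u = v")
  case False
  then have "\<exists>z>u. z < v \<and> v powr p - u powr p = (v - u) * (p * z powr (p - 1))"
    using assms by (intro MVT2) (auto intro!: derivative_eq_intros)
  then obtain z where z: "u < z" "z < v" "v powr p - u powr p = (v - u) * (p * z powr (p - 1))" by blast
  have "\<bar>p\<bar> * z powr (p - 1) \<le> \<bar>p\<bar> * e powr (p - 1)"
    by (rule mult_left_mono) (use assms z in \<open>auto intro!: powr_mono2'\<close>)
  then have "(v - u) * (\<bar>p\<bar> * z powr (p - 1)) \<le> (v - u) * (\<bar>p\<bar> * e powr (p - 1))"
    by (rule mult_left_mono) (use assms in auto)
  also have "\<dots> = \<bar>p\<bar> * e powr (p - 1) * (v - u)" by simp
  finally show ?thesis unfolding z(3) using assms by (simp only: abs_mult) simp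
qed simp

text \<open>Away from the support of \<open>F\<close> the kernel is evaluated away from its singularity.\<close>

lemma rl_integral_lipschitz_after_support:
  assumes a: "0 < a" "a \<le> 1" and F: "bounded_borel F" and supp: "\<And>s. c < s \<Longrightarrow> F s = 0" and c: "0 \<le> c" "c < c'"
  obtains L where "0 \<le> L" "\<And>t' t. c' \<le> t' \<Longrightarrow> t' \<le> t \<Longrightarrow> \<bar>rl_integral a F t - rl_integral a F t'\<bar> \<le> L * (t - t')"
proof -
  obtain M where M: "F \<in> borel_measurable borel" "0 \<le> M" "\<And>s. \<bar>F s\<bar> \<le> M"
    using bounded_borelE[OF F] by blast
  define B where "B = \<bar>a - 1\<bar> * (c' - c) powr (a - 2) / Gamma a"
  have B: "0 \<le> B" unfolding B_def using Gamma_real_pos[OF a(1)] by auto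
  have "\<bar>rl_integral a F t - rl_integral a F t'\<bar> \<le> (B * M * c) * (t - t')" if t: "c' \<le> t'" "t' \<le> t" for t t'
  proof -
    let ?f = "\<lambda>s. rl_kernel a (t - s) * (indicator {0..} s * F s) - rl_kernel a (t' - s) * (indicator {0..} s * F s)"
    let ?g = "\<lambda>s. (B * (t - t') * M) * indicator {0..c} s :: real"
    have f: "has_bochner_integral lborel ?f (rl_integral a F t - rl_integral a F t')"
      unfolding rl_integral_def
      by (intro has_bochner_integral_diff has_bochner_integral_integrable bounded_borel_integrable a F)
    have g: "has_bochner_integral lborel ?g (B * (t - t') * M * measure lborel {0..c})"
      by (intro has_bochner_integral_mult_right has_bochner_integral_real_indicator) (use c in auto)
    have le: "norm (?f s) \<le> ?g s" for s
    proof (cases "s \<in> {0..c}")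
      case True
      have "rl_kernel a (t - s) - rl_kernel a (t' - s) = ((t - s) powr (a - 1) - (t' - s) powr (a - 1)) / Gamma a"
        using True t c by (simp add: rl_kernel_def diff_divide_distrib)
      also have "\<bar>\<dots>\<bar> = \<bar>(t - s) powr (a - 1) - (t' - s) powr (a - 1)\<bar> / Gamma a"
        using Gamma_real_pos[OF a(1)] by simp
      also have "\<dots> \<le> (\<bar>a - 1\<bar> * (c' - c) powr (a - 1 - 1) * ((t - s) - (t' - s))) / Gamma a"
        using True t c a Gamma_real_pos[OF a(1)]
        by (intro divide_right_mono powr_lipschitz_away_from_zero) auto
      also have "\<dots> = B * (t - t')" unfolding B_def by simp
      finally have "\<bar>(rl_kernel a (t - s) - rl_kernel a (t' - s)) * F s\<bar> \<le> B * (t - t') * M"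
        unfolding abs_mult using M B t by (intro mult_mono) auto
      then show ?thesis using True by (simp add: algebra_simps)
    next
      case False
      then show ?thesis using supp[of s] by (auto simp: indicator_def)
    qed
    have "\<bar>rl_integral a F t - rl_integral a F t'\<bar> \<le> (\<integral>s. norm (?f s) \<partial>lborel)"
      using f integral_norm_bound[of lborel ?f] by (simp add: has_bochner_integral_iff)
    also have "\<dots> \<le> (\<integral>s. ?g s \<partial>lborel)"
      by (rule integral_mono) (use f g le in \<open>auto simp: has_bochner_integral_iff\<close>)
    also have "\<dots> = B * M * c * (t - t')"
      using has_bochner_integral_integral_eq[OF g] c by simp
    finally show ?thesis .
  qed
  moreover have "0 \<le> B * M * c" using B M c by auto
  ultimately show thesis using that by blast
qed

text \<open>The Hoelder bound of order \<open>a\<close> improves to little-o when \<open>F\<close> is continuous: the constant part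
\<open>F(T)\<close> and the remote past contribute functions that are Lipschitz near \<open>T\<close>, and on a short last
stretch \<open>F - F(T)\<close> is small. The maximum principle depends on this gain.\<close>

lemma rl_integral_little_holder:
  assumes a: "0 < a" "a < 1" and F: "continuous_on {0..T} F" and T: "0 < T" and e: "0 < e"
  obtains d where "0 < d" "d < T"
    "\<And>t. T - d \<le> t \<Longrightarrow> t \<le> T \<Longrightarrow> \<bar>rl_integral a F T - rl_integral a F t\<bar> \<le> e * (T - t) powr a"
proof -
  define \<eta> where "\<eta> = e * Gamma (a + 1) / 6"
  have G: "Gamma (a + 1) > 0" using a by (intro Gamma_real_pos) auto
  have \<eta>: "0 < \<eta>" using G e by (simp add: \<eta>_def)
  obtain d0 where d0: "0 < d0" "\<And>s. s \<in> {0..T} \<Longrightarrow> dist s T < d0 \<Longrightarrow> dist (F s) (F T) < \<eta>"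
    using F[unfolded continuous_on_iff, rule_format, of T \<eta>] \<eta> T by auto
  define c where "c = max (T / 2) (T - d0 / 2)"
  have c: "0 < c" "c < T" using T d0 by (auto simp: c_def)
  have near: "\<bar>F s - F T\<bar> \<le> \<eta>" if "c \<le> s" "s \<le> T" for s
  proof -
    have "dist s T < d0" using that d0 by (auto simp: c_def dist_real_def)
    then show ?thesis using d0(2)[of s] that c by (auto simp: dist_real_def)
  qed
  define F0 where "F0 = (\<lambda>s. indicator {0..T} s * (F s - F T))"
  have F0: "bounded_borel F0"
    unfolding F0_def using F by (intro bounded_borel_continuous continuous_intros)
  define F1 where "F1 = (\<lambda>s. indicator {..<c} s * F0 s)"
  define F2 where "F2 = (\<lambda>s. indicator {c..} s * F0 s)"
  have F1: "bounded_borel F1" and F2: "bounded_borel F2"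
    unfolding F1_def F2_def by (auto intro!: bounded_borel_indicator F0)
  have split: "rl_integral a F t = rl_integral a F1 t + rl_integral a F2 t + F T * t powr a / Gamma (a + 1)"
    if t: "0 \<le> t" "t \<le> T" for t
  proof -
    have "rl_integral a F t = rl_integral a (\<lambda>s. (F1 s + F2 s) + F T) t"
      by (rule rl_integral_cong) (use t in \<open>auto simp: F1_def F2_def F0_def indicator_def\<close>)
    also have "\<dots> = rl_integral a F1 t + rl_integral a F2 t + rl_integral a (\<lambda>_. F T) t"
      using a F1 F2 by (simp add: rl_integral_add bounded_borel_add bounded_borel_const)
    finally show ?thesis using rl_integral_const a t by simp
  qed
  define c' where "c' = (c + T) / 2"
  have c': "c < c'" "c' < T" using c by (auto simp: c'_def)
  obtain L1 where L1: "0 \<le> L1"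
    "\<And>t' t. c' \<le> t' \<Longrightarrow> t' \<le> t \<Longrightarrow> \<bar>rl_integral a F1 t - rl_integral a F1 t'\<bar> \<le> L1 * (t - t')"
    by (rule rl_integral_lipschitz_after_support[of a F1 c c']) (use a F1 c c' in \<open>auto simp: F1_def\<close>)
  define L2 where "L2 = \<bar>F T\<bar> * (\<bar>a\<bar> * c' powr (a - 1)) / Gamma (a + 1)"
  have L2: "0 \<le> L2" using G by (auto simp: L2_def)
  define L where "L = L1 + L2 + 1"
  have L: "0 < L" using L1 L2 by (simp add: L_def)
  have F2b: "\<bar>F2 s\<bar> \<le> \<eta>" for s
    using near[of s] \<eta> by (auto simp: F2_def F0_def indicator_def)
  \<comment> \<open>The second bound turns the Lipschitz part \<open>L h\<close> into at most \<open>(2 e / 3) h\<^sup>a\<close>; the last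
    stretch accounts for the remaining third, by the choice of \<open>\<eta>\<close>.\<close>
  define d where "d = min (T - c') ((2 * e / (3 * L)) powr (1 / (1 - a)))"
  have d: "0 < d" "d < T" using c' c e L by (auto simp: d_def min_def)
  show thesis
  proof (rule that[OF d])
    fix t assume t: "T - d \<le> t" "t \<le> T"
    define h where "h = T - t"
    have h: "0 \<le> h" "h \<le> d" using t by (auto simp: h_def)
    have ct: "c' \<le> t" using t d_def by auto
    have p1: "\<bar>rl_integral a F1 T - rl_integral a F1 t\<bar> \<le> L1 * h"
      unfolding h_def using L1(2) ct t by simp
    have "\<bar>rl_integral a F2 T - rl_integral a F2 t\<bar> \<le> 2 * \<eta> * (T - t) powr a / Gamma (a + 1)"
      by (rule rl_integral_holder) (use a F2 F2b ct t c c' in \<open>auto simp: bounded_borel_def\<close>)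
    also have "\<dots> = e / 3 * h powr a" using G by (simp add: \<eta>_def h_def)
    finally have p2: "\<bar>rl_integral a F2 T - rl_integral a F2 t\<bar> \<le> e / 3 * h powr a" .
    have "\<bar>T powr a - t powr a\<bar> \<le> \<bar>a\<bar> * c' powr (a - 1) * h"
      unfolding h_def using a ct t c c' by (intro powr_lipschitz_away_from_zero) auto
    then have "\<bar>F T\<bar> / Gamma (a + 1) * \<bar>T powr a - t powr a\<bar> \<le> \<bar>F T\<bar> / Gamma (a + 1) * (\<bar>a\<bar> * c' powr (a - 1) * h)"
      using G by (intro mult_left_mono) auto
    also have "\<dots> = L2 * h" by (simp add: L2_def)
    finally have p3: "\<bar>F T\<bar> / Gamma (a + 1) * \<bar>T powr a - t powr a\<bar> \<le> L2 * h" .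
    have "\<bar>F T * T powr a / Gamma (a + 1) - F T * t powr a / Gamma (a + 1)\<bar> = \<bar>F T\<bar> / Gamma (a + 1) * \<bar>T powr a - t powr a\<bar>"
      using G by (simp add: diff_divide_distrib[symmetric] right_diff_distrib[symmetric] abs_mult)
    then have "\<bar>rl_integral a F T - rl_integral a F t\<bar> \<le> L1 * h + e / 3 * h powr a + L2 * h"
      using p1 p2 p3 split[of T] split[of t] ct c c' t T by linarith
    also have "\<dots> \<le> L * h + e / 3 * h powr a"
      using h by (simp add: L_def algebra_simps)
    also have "L * h \<le> (2 * e / 3) * h powr a"
    proof (cases "h = 0")
      case False
      have "h powr (1 - a) \<le> ((2 * e / (3 * L)) powr (1 / (1 - a))) powr (1 - a)"
        using h a by (intro powr_mono2) (auto simp: d_def)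
      also have "\<dots> = 2 * e / (3 * L)" using a e L by (simp add: powr_powr)
      finally have "L * h powr (1 - a) \<le> 2 * e / 3" using L by (simp add: field_simps)
      then have "(L * h powr (1 - a)) * h powr a \<le> (2 * e / 3) * h powr a" by (intro mult_right_mono) auto
      moreover have "h powr (1 - a) * h powr a = h" using h False by (simp add: powr_add[symmetric])
      ultimately show ?thesis by (simp add: mult.assoc)
    qed simp
    finally show "\<bar>rl_integral a F T - rl_integral a F t\<bar> \<le> e * (T - t) powr a"
      by (simp add: h_def algebra_simps)
  qed
qed

text \<open>Let \<open>z\<close> have a negative minimum at \<open>m > 0\<close>, and let \<open>y = z - z(m) \<ge> 0\<close>. For \<open>a < 1\<close> the function
\<open>H = I\<^sup>1\<^sup>-\<^sup>a y\<close> has the derivative \<open>F(m) + y(0) m\<^sup>-\<^sup>a / \<Gamma>(1 - a) > 0\<close> at \<open>m\<close>. On the other hand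
\<open>y(m) = 0\<close>, so \<open>y\<close> is \<open>o(h\<^sup>a)\<close> on \<open>[m - h, m]\<close> and \<open>H(m) - H(m - h) \<le> o(h)\<close>, a contradiction. For
\<open>a = 1\<close> there is no memory to supply strictness; there \<open>z\<close> is nondecreasing from the last time before
\<open>m\<close> at which it is nonnegative.\<close>

lemma volterra_weak_maximum_principle:
  assumes a: "0 < a" "a \<le> 1" and F: "continuous_on {0..T} F"
    and z: "\<And>t. 0 \<le> t \<Longrightarrow> t \<le> T \<Longrightarrow> z t = z0 + rl_integral a F t" and z0: "0 \<le> z0"
    and sign: "\<And>t. 0 < t \<Longrightarrow> t \<le> T \<Longrightarrow> z t < 0 \<Longrightarrow> 0 \<le> F t"
    and t: "0 \<le> t" "t \<le> T"
  shows "0 \<le> z t"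
proof -
  have zc: "continuous_on {0..T} z"
    by (rule continuous_on_eq[of _ "\<lambda>t. z0 + rl_integral a F t"])
       (use z in \<open>auto intro!: continuous_intros continuous_on_rl_integral a F\<close>)
  obtain m where m: "m \<in> {0..T}" "\<And>s. s \<in> {0..T} \<Longrightarrow> z m \<le> z s"
    using continuous_attains_inf[OF _ _ zc] t by auto
  have zz0: "z 0 = z0" using z[of 0] t by (simp add: rl_integral_nonpos_time)
  have "0 \<le> z m"
  proof (rule ccontr)
    assume "\<not> 0 \<le> z m"
    then have neg: "z m < 0" by simp
    then have m0: "0 < m" using m(1) zz0 z0 by (cases "m = 0") auto
    have Fm: "continuous_on {0..m} F" using F m by (auto intro: continuous_on_subset)
    have zm: "continuous_on {0..m} z" using zc m by (auto intro: continuous_on_subset)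
    show False
    proof (cases "a = 1")
      case True
      define S where "S = {0..m} \<inter> z -` {0..}"
      have "closed S" unfolding S_def
        by (rule continuous_closed_preimage[OF zm]) auto
      then have "compact S" unfolding S_def
        by (metis compact_Icc compact_Int_closed inf.absorb_iff2 inf.cobounded1 inf_commute)
      moreover have "0 \<in> S" using z0 zz0 m0 by (simp add: S_def)
      ultimately obtain b where b: "b \<in> S" "\<And>s. s \<in> S \<Longrightarrow> s \<le> b" using compact_attains_sup[of S] by blast
      have b': "0 \<le> b" "b \<le> m" "0 \<le> z b" using b by (auto simp: S_def)
      have "z b \<le> z m"
      proof (rule DERIV_nonneg_imp_increasing_open[OF b'(2)])
        fix s assume s: "b < s" "s < m"
        have "z s < 0" using b(2)[of s] s b' by (force simp: S_def)
        then have "0 \<le> F s" using sign[of s] s b' m by auto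
        moreover have "(z has_real_derivative F s) (at s)"
        proof -
          have "(rl_integral 1 F has_real_derivative F s) (at s)"
            using rl_integral_one_deriv[OF Fm, of s] s b' at_within_Icc_at[of 0 s m] by auto
          then have "((\<lambda>s. z0 + rl_integral 1 F s) has_real_derivative F s) (at s)"
            by (auto intro!: derivative_eq_intros)
          then show ?thesis
            by (rule has_field_derivative_transform_within_open[where S="{0<..<m}"]) (use s b' z True m in auto)
        qed
        ultimately show "\<exists>y. (z has_real_derivative y) (at s) \<and> 0 \<le> y" by blast
      qed (use zm b' in \<open>auto intro: continuous_on_subset\<close>)
      then show False using neg b' by simp
    next
      case False
      with a have a1: "0 < a" "a < 1" "0 < 1 - a" "1 - a \<le> 1" by auto
      define y where "y = (\<lambda>s. z s - z m)"
      define y0 where "y0 = z0 - z m"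
      have y0: "0 < y0" using z0 neg by (simp add: y0_def)
      have yc: "continuous_on {0..m} y" unfolding y_def using zm by (intro continuous_intros)
      have y: "y s = y0 + rl_integral a F s" if "0 \<le> s" "s \<le> m" for s
        using z[of s] that m by (simp add: y_def y0_def)
      have ynn: "0 \<le> y s" if "0 \<le> s" "s \<le> m" for s using m that by (simp add: y_def)
      have ym: "y m = 0" by (simp add: y_def)
      define H where "H = rl_integral (1 - a) y"
      have G: "Gamma (2 - a) > 0" using a by (intro Gamma_real_pos) auto
      have H: "H s = y0 * s powr (1 - a) / Gamma (2 - a) + rl_integral 1 F s" if s: "0 \<le> s" "s \<le> m" for s
      proof -
        let ?J = "\<lambda>u. indicator {0..m} u * rl_integral a F u"
        have J: "bounded_borel ?J"
          by (intro bounded_borel_continuous continuous_on_rl_integral a Fm)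
        have "H s = rl_integral (1 - a) (\<lambda>u. y0 + ?J u) s"
          unfolding H_def by (rule rl_integral_cong) (use s y in auto)
        also have "\<dots> = y0 * s powr (1 - a) / Gamma (1 - a + 1) + rl_integral (1 - a) ?J s"
          using a1 s J by (simp add: rl_integral_add bounded_borel_const rl_integral_const)
        also have "rl_integral (1 - a) ?J s = rl_integral (1 - a) (rl_integral a F) s"
          by (rule rl_integral_cutoff) (use s in simp)
        also have "\<dots> = rl_integral 1 F s"
          using rl_integral_semigroup_continuous[OF a1(3,1) Fm s(2)] by simp
        finally show ?thesis by (simp add: algebra_simps)
      qed
      define D where "D = y0 * (1 - a) * m powr (- a) / Gamma (2 - a) + F m"
      have D: "0 < D" unfolding D_def
        using y0 a1 m0 G sign[of m] m neg by (intro add_pos_nonneg divide_pos_pos mult_pos_pos) auto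
      have HD: "(H has_real_derivative D) (at m within {0..m})"
      proof -
        have "((\<lambda>s. s powr (1 - a)) has_real_derivative (1 - a) * m powr (1 - a - 1)) (at m within {0..m})"
          using m0 by (intro has_real_derivative_powr[THEN has_field_derivative_at_within]) auto
        then have "((\<lambda>s. y0 / Gamma (2 - a) * s powr (1 - a)) has_real_derivative
           y0 / Gamma (2 - a) * ((1 - a) * m powr (1 - a - 1))) (at m within {0..m})"
          by (rule DERIV_cmult)
        then have "((\<lambda>s. y0 / Gamma (2 - a) * s powr (1 - a) + rl_integral 1 F s) has_real_derivative
           y0 / Gamma (2 - a) * ((1 - a) * m powr (1 - a - 1)) + F m) (at m within {0..m})"
          by (rule DERIV_add) (rule rl_integral_one_deriv[OF Fm], use m0 in simp)
        moreover have "y0 / Gamma (2 - a) * ((1 - a) * m powr (1 - a - 1)) + F m = D"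
          by (simp add: D_def)
        ultimately have "((\<lambda>s. y0 / Gamma (2 - a) * s powr (1 - a) + rl_integral 1 F s) has_real_derivative D)
          (at m within {0..m})" by simp
        then show ?thesis
          by (rule has_field_derivative_transform_within[where d=1]) (use m0 H in auto)
      qed
      \<comment> \<open>Half of the slope is kept, so \<open>H(m) - H(m - h) > (D / 2) h\<close> for small \<open>h\<close>.\<close>
      have "((\<lambda>s. H s - D / 2 * s) has_real_derivative D - D / 2) (at m within {0..m})"
        by (intro DERIV_diff HD) (auto intro!: derivative_eq_intros)
      then obtain d1 where d1: "0 < d1"
        "\<And>h. 0 < h \<Longrightarrow> m - h \<in> {0..m} \<Longrightarrow> h < d1 \<Longrightarrow> H (m - h) - D / 2 * (m - h) < H m - D / 2 * m"
        using has_real_derivative_pos_inc_left[of "\<lambda>s. H s - D / 2 * s" "D - D / 2" m "{0..m}"] D by auto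
      \<comment> \<open>With this constant the little-o bound for \<open>y\<close> allows \<open>H\<close> an increase of at most \<open>(D / 2) h\<close>.\<close>
      define e where "e = Gamma (2 - a) * D / 2"
      have e: "0 < e" using G D by (simp add: e_def)
      obtain d2 where d2: "0 < d2" "d2 < m"
        "\<And>t. m - d2 \<le> t \<Longrightarrow> t \<le> m \<Longrightarrow> \<bar>rl_integral a F m - rl_integral a F t\<bar> \<le> e * (m - t) powr a"
        using rl_integral_little_holder[OF a1(1,2) Fm m0 e] by blast
      define h where "h = min (d1 / 2) d2"
      have h: "0 < h" "h < d1" "h \<le> d2" using d1 d2 by (auto simp: h_def)
      have inc: "D / 2 * h < H m - H (m - h)"
        using d1(2)[of h] h d2 by (simp add: algebra_simps diff_divide_distrib)
      let ?y = "\<lambda>s. indicator {0..m} s * y s"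
      have "rl_integral (1 - a) ?y m - rl_integral (1 - a) ?y (m - h) \<le> (e * h powr a) * (m - (m - h)) powr (1 - a) / Gamma (1 - a + 1)"
      proof (rule rl_integral_increment_le)
        fix s assume s: "m - h \<le> s" "s < m"
        have "y s = rl_integral a F s - rl_integral a F m"
          using y[of s] y[of m] ym s h d2 by auto
        also have "\<dots> \<le> e * (m - s) powr a" using d2(3)[of s] s h by auto
        also have "\<dots> \<le> e * h powr a" using e s h a by (intro mult_left_mono powr_mono2) auto
        finally show "?y s \<le> e * h powr a" using s h d2 by simp
      qed (use a1 h d2 ynn yc in \<open>auto intro!: bounded_borel_continuous\<close>)
      also have "\<dots> = e * h / Gamma (2 - a)"
      proof -
        have "h powr a * h powr (1 - a) = h" using h by (simp add: powr_add[symmetric])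
        then show ?thesis by (simp add: mult.assoc)
      qed
      also have "\<dots> = D / 2 * h" using G by (simp add: e_def)
      finally have "H m - H (m - h) \<le> D / 2 * h"
        unfolding H_def using h by (simp add: rl_integral_cutoff)
      with inc show False by simp
    qed
  qed
  then show ?thesis using m(2)[of t] t by simp
qed

section \<open>Existence and uniqueness for Volterra systems\<close>

lemma rl_kernel_laplace:
  assumes a: "0 < a" and l: "0 < l"
  shows "has_bochner_integral lborel (\<lambda>u. rl_kernel a u * exp (- l * u)) (l powr (- a))"
proof -
  have G: "Gamma a > 0" using a by (rule Gamma_real_pos)
  have "has_bochner_integral lborel (\<lambda>u. indicator {0..} u * u powr (a - 1) / exp u) (Gamma a)"
    by (rule has_bochner_integral_nn_integral)
       (use G Gamma_conv_nn_integral_real[OF a] in \<open>auto simp: indicator_def\<close>)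
  then have "has_bochner_integral lborel (\<lambda>u. indicator {0..} (0 + l * u) * (0 + l * u) powr (a - 1) / exp (0 + l * u)) (Gamma a /\<^sub>R \<bar>l\<bar>)"
    using l by (subst lborel_has_bochner_integral_real_affine_iff[symmetric]) auto
  then have "has_bochner_integral lborel (\<lambda>u. l powr (1 - a) / Gamma a * (indicator {0..} (0 + l * u) * (0 + l * u) powr (a - 1) / exp (0 + l * u)))
     (l powr (1 - a) / Gamma a * (Gamma a /\<^sub>R \<bar>l\<bar>))"
    by (rule has_bochner_integral_mult_right)
  moreover have "l powr (1 - a) / Gamma a * (Gamma a /\<^sub>R \<bar>l\<bar>) = l powr (- a)"
    using l G by (simp add: powr_diff powr_minus field_simps)
  moreover have "l powr (1 - a) / Gamma a * (indicator {0..} (0 + l * u) * (0 + l * u) powr (a - 1) / exp (0 + l * u))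
     = rl_kernel a u * exp (- l * u)" for u
  proof (cases "0 < u")
    case True
    have "l powr (1 - a) * l powr (a - 1) = 1" using l by (simp add: powr_add[symmetric])
    then have "l powr (1 - a) * (l * u) powr (a - 1) = u powr (a - 1)"
      using True l by (simp add: powr_mult mult.assoc[symmetric])
    then show ?thesis using True l by (simp add: rl_kernel_def exp_minus divide_inverse mult.commute mult.left_commute)
  next
    case False
    then have "l * u < 0 \<or> u = 0" using l by (auto simp: mult_less_0_iff)
    then show ?thesis using False by (auto simp: rl_kernel_def)
  qed
  ultimately show ?thesis by simp
qed

text \<open>The Laplace transform of the kernel is \<open>l\<close> to the power \<open>-a\<close>. A large rate \<open>l\<close> makes the
integral a small operator in the norm weighted by \<open>exp (- l t)\<close>.\<close>

lemma rl_integral_exp_bound: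
  assumes a: "0 < a" and l: "0 < l" and F: "bounded_borel F" and B: "0 \<le> B"
    and le: "\<And>s. 0 \<le> s \<Longrightarrow> s < t \<Longrightarrow> \<bar>F s\<bar> \<le> B * exp (l * s)"
  shows "\<bar>rl_integral a F t\<bar> \<le> B * l powr (- a) * exp (l * t)"
proof -
  let ?f = "\<lambda>s. rl_kernel a (t - s) * (indicator {0..} s * F s)"
  let ?g = "\<lambda>s. B * exp (l * t) * (rl_kernel a (t + (- 1) * s) * exp (- l * (t + (- 1) * s)))"
  have f: "has_bochner_integral lborel ?f (rl_integral a F t)"
    unfolding rl_integral_def
    by (intro has_bochner_integral_integrable bounded_borel_integrable a F)
  have "has_bochner_integral lborel (\<lambda>s. rl_kernel a (t + (- 1) * s) * exp (- l * (t + (- 1) * s))) (l powr (- a) /\<^sub>R \<bar>- 1\<bar>)"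
    by (rule lborel_has_bochner_integral_real_affine_iff[of "- 1" "\<lambda>u. rl_kernel a u * exp (- l * u)", THEN iffD1])
       (use rl_kernel_laplace[OF a l] in auto)
  then have g: "has_bochner_integral lborel ?g (B * exp (l * t) * (l powr (- a) /\<^sub>R \<bar>- 1\<bar>))"
    by (rule has_bochner_integral_mult_right)
  have le': "norm (?f s) \<le> ?g s" for s
  proof (cases "0 \<le> s \<and> s < t")
    case True
    have "\<bar>F s\<bar> * rl_kernel a (t - s) \<le> (B * exp (l * s)) * rl_kernel a (t - s)"
      using True le rl_kernel_nonneg[OF a] by (intro mult_right_mono) auto
    moreover have "exp (l * t) * exp (- l * (t + (- 1) * s)) = exp (l * s)"
      by (simp add: exp_add[symmetric] algebra_simps)
    then have "?g s = (B * exp (l * s)) * rl_kernel a (t - s)"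
      by (metis add_uminus_conv_diff mult.assoc mult.commute mult_minus1)
    moreover have "norm (?f s) = \<bar>F s\<bar> * rl_kernel a (t - s)"
      using True rl_kernel_nonneg[OF a, of "t - s"] by (simp add: abs_mult mult.commute)
    ultimately show ?thesis by (simp only:)
  next
    case False
    then have "?f s = 0" by (auto simp: rl_kernel_def)
    then have "norm (?f s) = 0" by (simp only: norm_zero)
    moreover have "0 \<le> ?g s" using B rl_kernel_nonneg[OF a, of "t - s"] by simp
    ultimately show ?thesis by (simp only:)
  qed
  have "\<bar>rl_integral a F t\<bar> \<le> (\<integral>s. norm (?f s) \<partial>lborel)"
    unfolding rl_integral_def using integral_norm_bound[of lborel ?f] by simp
  also have "\<dots> \<le> (\<integral>s. ?g s \<partial>lborel)"
    by (rule integral_mono) (use f g le' in \<open>auto simp: has_bochner_integral_iff\<close>)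
  also have "\<dots> = B * l powr (- a) * exp (l * t)"
    using has_bochner_integral_integral_eq[OF g] by simp
  finally show ?thesis .
qed

lemma exp_weight_contracts:
  fixes \<alpha> :: "real ^ 'd"
  assumes "\<And>i. 0 < \<alpha> $ i"
  obtains l where "0 < l" "(\<Sum>i\<in>UNIV. L * l powr (- \<alpha> $ i)) \<le> 1 / 2"
proof -
  have "((\<lambda>l. \<Sum>i\<in>UNIV. L * l powr (- \<alpha> $ i)) \<longlongrightarrow> (\<Sum>i\<in>(UNIV::'d set). L * 0)) at_top"
    using assms by (intro tendsto_intros tendsto_neg_powr filterlim_ident) auto
  then have "\<forall>\<^sub>F l in at_top. (\<Sum>i\<in>UNIV. L * l powr (- \<alpha> $ i)) < 1 / 2"
    by (rule order_tendstoD) simp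
  then have "\<forall>\<^sub>F l in at_top. (\<Sum>i\<in>UNIV. L * l powr (- \<alpha> $ i)) < 1 / 2 \<and> 0 < l"
    using eventually_gt_at_top[of 0] by eventually_elim simp
  then obtain l where "(\<Sum>i\<in>UNIV. L * l powr (- \<alpha> $ i)) < 1 / 2" "0 < l"
    by (metis (no_types, lifting) eventually_happens trivial_limit_at_top_linorder)
  then show thesis using that by force
qed

text \<open>The right hand sides are Lipschitz with respect to the history on \<open>[0, t]\<close>, which covers delays. The maximum of the exponentially weighted distance is at most half of itself.\<close>

lemma volterra_unique:
  fixes x y Fx Fy :: "real \<Rightarrow> real ^ 'd" and \<alpha> :: "real ^ 'd"
  assumes \<alpha>: "\<And>i. 0 < \<alpha> $ i"
    and cont: "continuous_on {0..T} x" "continuous_on {0..T} y" "continuous_on {0..T} Fx" "continuous_on {0..T} Fy"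
    and x: "\<And>t i. 0 \<le> t \<Longrightarrow> t \<le> T \<Longrightarrow> x t $ i = x0 $ i + rl_integral (\<alpha> $ i) (\<lambda>s. Fx s $ i) t"
    and y: "\<And>t i. 0 \<le> t \<Longrightarrow> t \<le> T \<Longrightarrow> y t $ i = x0 $ i + rl_integral (\<alpha> $ i) (\<lambda>s. Fy s $ i) t"
    and L: "0 \<le> L"
    and lip: "\<And>t D. 0 \<le> t \<Longrightarrow> t \<le> T \<Longrightarrow> (\<And>s. 0 \<le> s \<Longrightarrow> s \<le> t \<Longrightarrow> norm (x s - y s) \<le> D) \<Longrightarrow>
          norm (Fx t - Fy t) \<le> L * D"
    and t: "0 \<le> t" "t \<le> T"
  shows "x t = y t"
proof -
  obtain l where l: "0 < l" "(\<Sum>i\<in>UNIV. L * l powr (- \<alpha> $ i)) \<le> 1 / 2"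
    using exp_weight_contracts[of \<alpha> L] \<alpha> by blast
  define e where "e = (\<lambda>t. exp (- l * t) * norm (x t - y t))"
  have "continuous_on {0..T} e" unfolding e_def using cont by (intro continuous_intros)
  then obtain m where m: "m \<in> {0..T}" "\<And>s. s \<in> {0..T} \<Longrightarrow> e s \<le> e m"
    using continuous_attains_sup[of "{0..T}" e] t by auto
  define S where "S = e m"
  have S0: "0 \<le> S" by (simp add: S_def e_def)
  have S: "norm (x s - y s) \<le> S * exp (l * s)" if "0 \<le> s" "s \<le> T" for s
  proof -
    have "e s * exp (l * s) \<le> S * exp (l * s)" using m(2)[of s] that by (simp add: S_def)
    moreover have "e s * exp (l * s) = norm (x s - y s)" by (simp add: e_def exp_minus)
    ultimately show ?thesis by simp
  qed
  have m': "0 \<le> m" "m \<le> T" using m by auto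
  have comp: "\<bar>(x m - y m) $ i\<bar> \<le> L * l powr (- \<alpha> $ i) * (S * exp (l * m))" for i
  proof -
    let ?X = "\<lambda>s. indicator {0..T} s * Fx s $ i" and ?Y = "\<lambda>s. indicator {0..T} s * Fy s $ i"
    have X: "bounded_borel ?X" and Y: "bounded_borel ?Y"
      by (intro bounded_borel_continuous continuous_on_component cont)+
    have "(x m - y m) $ i = rl_integral (\<alpha> $ i) ?X m - rl_integral (\<alpha> $ i) ?Y m"
      using x[OF m'] y[OF m'] m' by (simp add: rl_integral_cutoff)
    also have "\<dots> = rl_integral (\<alpha> $ i) (\<lambda>s. ?X s - ?Y s) m"
      using rl_integral_diff[OF \<alpha> X Y] by simp
    also have "\<bar>\<dots>\<bar> \<le> (L * S) * l powr (- \<alpha> $ i) * exp (l * m)"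
    proof (rule rl_integral_exp_bound)
      fix s assume s: "0 \<le> s" "s < m"
      have "\<bar>(Fx s - Fy s) $ i\<bar> \<le> norm (Fx s - Fy s)" by (rule component_le_norm_cart)
      also have "\<dots> \<le> L * (S * exp (l * s))"
      proof (rule lip)
        fix r assume r: "0 \<le> r" "r \<le> s"
        have "norm (x r - y r) \<le> S * exp (l * r)" using S r s m' by simp
        also have "\<dots> \<le> S * exp (l * s)" using S0 l r by (intro mult_left_mono) auto
        finally show "norm (x r - y r) \<le> S * exp (l * s)" .
      qed (use s m' in auto)
      finally show "\<bar>?X s - ?Y s\<bar> \<le> L * S * exp (l * s)" using s m' by simp
    qed (use \<alpha> l X Y L S0 in \<open>auto intro: bounded_borel_diff\<close>)
    finally show ?thesis by (simp add: ac_simps)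
  qed
  have "norm (x m - y m) \<le> (\<Sum>i\<in>UNIV. \<bar>(x m - y m) $ i\<bar>)" by (rule norm_le_l1_cart)
  also have "\<dots> \<le> (\<Sum>i\<in>UNIV. L * l powr (- \<alpha> $ i) * (S * exp (l * m)))" by (intro sum_mono comp)
  also have "\<dots> = (\<Sum>i\<in>UNIV. L * l powr (- \<alpha> $ i)) * (S * exp (l * m))" by (simp add: sum_distrib_right)
  also have "\<dots> \<le> 1 / 2 * (S * exp (l * m))" using l S0 by (intro mult_right_mono) auto
  finally have "exp (- l * m) * norm (x m - y m) \<le> exp (- l * m) * (1 / 2 * (S * exp (l * m)))"
    by (intro mult_left_mono) auto
  moreover have "exp (- l * m) * (1 / 2 * (S * exp (l * m))) = 1 / 2 * S" by (simp add: exp_minus)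
  ultimately have "S \<le> 1 / 2 * S" by (simp only: S_def e_def)
  then have "S = 0" using S0 by simp
  then show ?thesis using S[OF t] by simp
qed

text \<open>Here \<open>N\<close> is a history-dependent right hand side. The integral vanishes for \<open>t \<le> 0\<close>, so a single
function \<open>\<psi>\<close> can prescribe the initial function on the negative half-line and the initial value on the
positive one. The unknown is
\<open>u(t) = exp (- l max(0, t)) x(t)\<close>, a bounded continuous function on the line, for which the
integral equation is a contraction in the supremum norm.\<close>

lemma volterra_exists:
  fixes \<psi> :: "real \<Rightarrow> real ^ 'd" and \<alpha> :: "real ^ 'd" and N :: "(real \<Rightarrow> real ^ 'd) \<Rightarrow> real \<Rightarrow> real ^ 'd"
  assumes \<alpha>: "\<And>i. 0 < \<alpha> $ i \<and> \<alpha> $ i \<le> 1"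
    and \<psi>: "continuous_on UNIV \<psi>" "\<And>t. norm (\<psi> t) \<le> P"
    and Ncont: "\<And>x. continuous_on UNIV x \<Longrightarrow> continuous_on UNIV (N x)"
    and Nbound: "\<And>x t. norm (N x t) \<le> B"
    and L: "0 \<le> L"
    and Nlip: "\<And>x y t D. 0 \<le> t \<Longrightarrow> (\<And>s. s \<le> t \<Longrightarrow> norm (x s - y s) \<le> D) \<Longrightarrow> norm (N x t - N y t) \<le> L * D"
  obtains x where "continuous_on UNIV x"
    "\<And>t i. x t $ i = \<psi> t $ i + rl_integral (\<alpha> $ i) (\<lambda>s. N x s $ i) t"
proof -
  obtain l where l: "0 < l" "(\<Sum>i\<in>UNIV. L * l powr (- \<alpha> $ i)) \<le> 1 / 2"
    using exp_weight_contracts[of \<alpha> L] \<alpha> by blast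
  define X where "X = (\<lambda>u t. exp (l * max 0 t) *\<^sub>R (u t :: real ^ 'd))"
  define V where "V = (\<lambda>x t. \<psi> t + (\<chi> i. rl_integral (\<alpha> $ i) (\<lambda>s. N x s $ i) t))"
  define W where "W = (\<lambda>u t. exp (- l * max 0 t) *\<^sub>R V (X u) t)"
  have Xc: "continuous_on UNIV (X (apply_bcontfun u))" for u :: "real \<Rightarrow>\<^sub>C (real ^ 'd)"
    unfolding X_def by (intro continuous_intros) auto
  have bb: "bounded_borel (\<lambda>s. N x s $ i)" if "continuous_on UNIV x" for x i
  proof -
    have "continuous_on UNIV (\<lambda>s. N x s $ i)" by (intro continuous_intros Ncont that)
    moreover have "\<bar>N x s $ i\<bar> \<le> B" for s using component_le_norm_cart[of "N x s" i] Nbound[of x s] by linarith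
    ultimately show ?thesis unfolding bounded_borel_def by (auto intro: borel_measurable_continuous_onI)
  qed
  have B0: "0 \<le> B" using Nbound[of "\<lambda>_. 0" 0] norm_ge_zero order_trans by blast
  have Vc: "continuous_on UNIV (V x)" if "continuous_on UNIV x" for x
    unfolding V_def using \<alpha> that
    by (intro continuous_intros \<psi> continuous_on_vec_lambda continuous_on_rl_integral_bounded bb) auto
  have expm: "exp (- l * max 0 t) * exp (l * max 0 t) = 1" for t by (simp add: exp_minus)
  have Wbcont: "W (apply_bcontfun u) \<in> bcontfun" for u
  proof (rule bcontfun_normI)
    show "continuous_on UNIV (W (apply_bcontfun u))"
      unfolding W_def by (intro continuous_intros Vc Xc)
    fix t
    have c: "\<bar>rl_integral (\<alpha> $ i) (\<lambda>s. N (X u) s $ i) t\<bar> \<le> B * l powr (- \<alpha> $ i) * exp (l * max 0 t)" for i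
    proof -
      have "\<bar>rl_integral (\<alpha> $ i) (\<lambda>s. N (X u) s $ i) (max 0 t)\<bar> \<le> B * l powr (- \<alpha> $ i) * exp (l * max 0 t)"
      proof (rule rl_integral_exp_bound)
        fix s :: real assume s: "0 \<le> s"
        have "\<bar>N (X u) s $ i\<bar> \<le> B" using component_le_norm_cart[of "N (X u) s" i] Nbound[of "X u" s] by linarith
        also have "\<dots> \<le> B * exp (l * s)" using B0 l s by (simp add: mult_le_cancel_left1)
        finally show "\<bar>N (X u) s $ i\<bar> \<le> B * exp (l * s)" .
      qed (use \<alpha> l B0 bb[OF Xc] in auto)
      then show ?thesis using B0 by (cases "0 \<le> t") (auto simp: max_def rl_integral_nonpos_time)
    qed
    have "norm (V (X u) t) \<le> norm (\<psi> t) + norm (\<chi> i. rl_integral (\<alpha> $ i) (\<lambda>s. N (X u) s $ i) t)"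
      unfolding V_def by (rule norm_triangle_ineq)
    also have "\<dots> \<le> P + (\<Sum>i\<in>UNIV. \<bar>(\<chi> i. rl_integral (\<alpha> $ i) (\<lambda>s. N (X u) s $ i) t) $ i\<bar>)"
      by (intro add_mono \<psi> norm_le_l1_cart)
    also have "\<dots> \<le> P + (\<Sum>i\<in>UNIV. B * l powr (- \<alpha> $ i) * exp (l * max 0 t))"
      using c by (intro add_left_mono sum_mono) simp
    also have "\<dots> \<le> P * exp (l * max 0 t) + (\<Sum>i\<in>UNIV. B * l powr (- \<alpha> $ i)) * exp (l * max 0 t)"
    proof -
      have "0 \<le> P" using \<psi>(2)[of 0] norm_ge_zero order_trans by blast
      then have "P * 1 \<le> P * exp (l * max 0 t)" using l by (intro mult_left_mono) auto
      then show ?thesis by (simp add: sum_distrib_right)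
    qed
    finally have "exp (- l * max 0 t) * norm (V (X u) t) \<le> exp (- l * max 0 t) * ((P + (\<Sum>i\<in>UNIV. B * l powr (- \<alpha> $ i))) * exp (l * max 0 t))"
      by (intro mult_left_mono) (auto simp: distrib_right)
    also have "\<dots> = P + (\<Sum>i\<in>UNIV. B * l powr (- \<alpha> $ i))"
      by (simp add: exp_minus)
    finally show "norm (W u t) \<le> P + (\<Sum>i\<in>UNIV. B * l powr (- \<alpha> $ i))"
      by (simp add: W_def)
  qed
  define \<Psi> where "\<Psi> = (\<lambda>u. Bcontfun (W (apply_bcontfun u)))"
  have \<Psi>: "apply_bcontfun (\<Psi> u) = W (apply_bcontfun u)" for u
    unfolding \<Psi>_def by (rule Bcontfun_inverse[OF Wbcont])
  have "dist (\<Psi> u) (\<Psi> v) \<le> 1 / 2 * dist u v" for u v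
  proof (rule dist_bound)
    fix t
    define D where "D = dist u v"
    have D0: "0 \<le> D" by (simp add: D_def)
    have xd: "norm (X u s - X v s) \<le> exp (l * max 0 s) * D" for s
    proof -
      have "norm (X u s - X v s) = exp (l * max 0 s) * dist (u s) (v s)"
        by (simp add: X_def scaleR_diff_right[symmetric] dist_norm)
      also have "\<dots> \<le> exp (l * max 0 s) * D" unfolding D_def by (intro mult_left_mono dist_bounded) auto
      finally show ?thesis .
    qed
    have c: "\<bar>(V (X u) t - V (X v) t) $ i\<bar> \<le> L * l powr (- \<alpha> $ i) * (D * exp (l * max 0 t))" for i
    proof (cases "0 \<le> t")
      case True
      have "(V (X u) t - V (X v) t) $ i = rl_integral (\<alpha> $ i) (\<lambda>s. N (X u) s $ i - N (X v) s $ i) t"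
        unfolding V_def using \<alpha> by (simp add: rl_integral_diff bb Xc)
      also have "\<bar>\<dots>\<bar> \<le> (L * D) * l powr (- \<alpha> $ i) * exp (l * t)"
      proof (rule rl_integral_exp_bound)
        fix s assume s: "0 \<le> s" "s < t"
        have "\<bar>(N (X u) s - N (X v) s) $ i\<bar> \<le> norm (N (X u) s - N (X v) s)" by (rule component_le_norm_cart)
        also have "\<dots> \<le> L * (exp (l * s) * D)"
        proof (rule Nlip[OF s(1)])
          fix r assume "r \<le> s"
          then have "exp (l * max 0 r) * D \<le> exp (l * s) * D"
            using l s D0 by (intro mult_right_mono) auto
          then show "norm (X u r - X v r) \<le> exp (l * s) * D" using xd[of r] by simp
        qed
        finally show "\<bar>N (X u) s $ i - N (X v) s $ i\<bar> \<le> L * D * exp (l * s)" by (simp add: ac_simps)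
      qed (use \<alpha> l L D0 in \<open>auto intro!: bounded_borel_diff bb Xc\<close>)
      finally show ?thesis using True by (simp add: ac_simps)
    next
      case False
      then show ?thesis using L D0 by (simp add: V_def rl_integral_nonpos_time)
    qed
    have "norm (V (X u) t - V (X v) t) \<le> (\<Sum>i\<in>UNIV. \<bar>(V (X u) t - V (X v) t) $ i\<bar>)" by (rule norm_le_l1_cart)
    also have "\<dots> \<le> (\<Sum>i\<in>UNIV. L * l powr (- \<alpha> $ i) * (D * exp (l * max 0 t)))" by (intro sum_mono c)
    also have "\<dots> = (\<Sum>i\<in>UNIV. L * l powr (- \<alpha> $ i)) * (D * exp (l * max 0 t))" by (simp add: sum_distrib_right)
    also have "\<dots> \<le> 1 / 2 * (D * exp (l * max 0 t))" using l D0 by (intro mult_right_mono) auto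
    finally have "exp (- l * max 0 t) * norm (V (X u) t - V (X v) t) \<le> exp (- l * max 0 t) * (1 / 2 * (D * exp (l * max 0 t)))"
      by (intro mult_left_mono) auto
    also have "\<dots> = 1 / 2 * D" by (simp add: exp_minus)
    finally show "dist (\<Psi> u t) (\<Psi> v t) \<le> 1 / 2 * dist u v"
      unfolding \<Psi> W_def D_def by (simp add: dist_norm scaleR_diff_right[symmetric])
  qed
  then obtain u where u: "\<Psi> u = u"
    using banach_fix_type[of "1/2" \<Psi>] by auto
  have fixed: "X u t = V (X u) t" for t
  proof -
    have "u t = W u t" using \<Psi>[of u] u by simp
    then have "X u t = exp (l * max 0 t) *\<^sub>R W u t" by (simp add: X_def)
    also have "\<dots> = V (X u) t" unfolding W_def using expm[of t] by (simp add: mult.commute)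
    finally show ?thesis .
  qed
  have "X u t $ i = \<psi> t $ i + rl_integral (\<alpha> $ i) (\<lambda>s. N (X u) s $ i) t" for t i
    by (subst fixed) (simp add: V_def)
  then show thesis using that Xc by blast
qed

section \<open>The Mittag-Leffler function\<close>

text \<open>Powers of \<open>t powr b\<close> are used instead of \<open>t powr (b * k)\<close>, so that the term with \<open>k = 0\<close> is 1 also
at \<open>t = 0\<close>.\<close>

definition ml_term :: "real \<Rightarrow> nat \<Rightarrow> real \<Rightarrow> real"
  where "ml_term b k t = (t powr b) ^ k / Gamma (b * real k + 1)"

lemma ml_term_eq_rl_integral:
  assumes "0 < b" "0 < k" "0 \<le> t"
  shows "ml_term b k t = rl_integral (b * real k) (\<lambda>_. 1) t"
proof -
  have "(t powr b) ^ k = t powr (b * real k)"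
    using assms by (cases "t = 0") (auto simp: powr_powr[symmetric] powr_realpow[symmetric])
  then show ?thesis using assms by (simp add: ml_term_def rl_integral_const)
qed

lemma rl_integral_ml_term:
  assumes b: "0 < b" and t: "0 \<le> t"
  shows "rl_integral b (ml_term b k) t = ml_term b (Suc k) t"
proof (cases "k = 0")
  case True
  have "rl_integral b (ml_term b k) t = rl_integral b (\<lambda>_. 1) t"
    by (rule rl_integral_cong) (use True in \<open>simp add: ml_term_def\<close>)
  then show ?thesis using ml_term_eq_rl_integral[of b 1 t] True b t by simp
next
  case False
  have "rl_integral b (ml_term b k) t = rl_integral b (rl_integral (b * real k) (\<lambda>_. 1)) t"
    by (rule rl_integral_cong) (use False b in \<open>simp add: ml_term_eq_rl_integral\<close>)
  also have "\<dots> = rl_integral (b + b * real k) (\<lambda>_. 1) t"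
    by (rule rl_integral_semigroup) (use b False in \<open>auto intro: bounded_borel_const\<close>)
  also have "\<dots> = ml_term b (Suc k) t"
    using ml_term_eq_rl_integral[of b "Suc k" t] b t by (simp add: algebra_simps)
  finally show ?thesis .
qed

text \<open>The growth of the Gamma function comes from the exponential bound on \<open>I\<close> of order \<open>b k\<close> applied to
the constant 1, evaluated at time 1: it gives \<open>1 / \<Gamma>(b k + 1) \<le> exp l / l\<^sup>b\<^sup>k\<close> for every \<open>l > 0\<close>.\<close>

lemma summable_mittag_leffler:
  assumes b: "0 < b"
  shows "summable (\<lambda>k. x ^ k / Gamma (b * real k + 1))"
proof -
  \<comment> \<open>With this rate the series is dominated by a geometric series of ratio \<open>1/2\<close>.\<close>
  define l where "l = (2 * (\<bar>x\<bar> + 1)) powr (1 / b)"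
  have l: "0 < l" unfolding l_def by simp
  have lb: "l powr b = 2 * (\<bar>x\<bar> + 1)" unfolding l_def using b by (simp add: powr_powr)
  have Gpos: "Gamma (b * real k + 1) > 0" for k using b by (intro Gamma_real_pos) (simp add: add_nonneg_pos)
  have inv: "1 / Gamma (b * real k + 1) \<le> exp l / (2 * (\<bar>x\<bar> + 1)) ^ k" for k
  proof (cases "k = 0")
    case False
    have "\<bar>rl_integral (b * real k) (\<lambda>_. 1) 1\<bar> \<le> 1 * l powr (- (b * real k)) * exp (l * 1)"
      by (rule rl_integral_exp_bound) (use b l False in \<open>auto intro: bounded_borel_const\<close>)
    also have "l powr (- (b * real k)) = 1 / (l powr b) ^ k"
      using l by (simp add: powr_minus powr_powr[symmetric] powr_realpow divide_inverse)
    finally show ?thesis using b False Gpos[of k] by (simp add: rl_integral_const lb)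
  qed (use l in simp)
  show ?thesis
  proof (rule summable_comparison_test')
    show "summable (\<lambda>k. exp l * (1 / 2) ^ k)" by (intro summable_mult summable_geometric) simp
    fix k :: nat
    have "norm (x ^ k / Gamma (b * real k + 1)) = \<bar>x\<bar> ^ k * (1 / Gamma (b * real k + 1))"
      using Gpos[of k] by (simp add: power_abs)
    also have "\<dots> \<le> \<bar>x\<bar> ^ k * (exp l / (2 * (\<bar>x\<bar> + 1)) ^ k)"
      using inv by (intro mult_left_mono) auto
    also have "\<dots> = exp l * (\<bar>x\<bar> / (2 * (\<bar>x\<bar> + 1))) ^ k" by (simp add: power_divide)
    also have "\<dots> \<le> exp l * (1 / 2) ^ k"
      by (intro mult_left_mono power_mono) (auto simp: divide_simps)
    finally show "norm (x ^ k / Gamma (b * real k + 1)) \<le> exp l * (1 / 2) ^ k" .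
  qed
qed

lemma isCont_mittag_leffler:
  assumes b: "0 < b"
  shows "isCont (mittag_leffler b) x"
proof -
  have "isCont (\<lambda>x. \<Sum>k. (1 / Gamma (b * real k + 1)) * x ^ k) x"
    by (rule isCont_powser_converges_everywhere) (use summable_mittag_leffler[OF b] in simp)
  then show ?thesis by (simp add: mittag_leffler_def[abs_def])
qed

lemma mittag_leffler_0: "mittag_leffler b 0 = 1"
  unfolding mittag_leffler_def using powser_zero[of "\<lambda>k. 1 / Gamma (b * real k + 1)"] by simp

lemma continuous_on_mittag_leffler_powr:
  assumes b: "0 < b"
  shows "continuous_on {0..} (\<lambda>t. mittag_leffler b (- c * t powr b))"
proof -
  have 1: "continuous_on {0..} (\<lambda>t. - c * t powr b)"
    using b by (intro continuous_intros continuous_on_powr') auto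
  have "continuous_on UNIV (mittag_leffler b)"
    by (intro continuous_at_imp_continuous_on ballI isCont_mittag_leffler b)
  from continuous_on_compose2[OF this 1] show ?thesis by auto
qed

text \<open>The operator \<open>I\<^sup>b\<close> shifts the terms of the series. Dominated convergence justifies the passage from
partial sums to the limit.\<close>

lemma mittag_leffler_volterra:
  assumes b: "0 < b" and c: "0 < c" and t: "0 \<le> t"
  shows "mittag_leffler b (- c * t powr b) = 1 + rl_integral b (\<lambda>s. - c * mittag_leffler b (- c * s powr b)) t"
proof -
  define u where "u = (\<lambda>t. mittag_leffler b (- c * t powr b))"
  define S where "S = (\<lambda>n t. \<Sum>k<n. (- c) ^ k * ml_term b k t)"
  have Gpos: "Gamma (b * real k + 1) > 0" for k using b by (intro Gamma_real_pos) (simp add: add_nonneg_pos)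
  have Su: "(\<lambda>n. S n s) \<longlonglongrightarrow> u s" for s
  proof -
    have "(\<lambda>k. (- c * s powr b) ^ k / Gamma (b * real k + 1)) sums u s"
      unfolding u_def mittag_leffler_def by (rule summable_sums[OF summable_mittag_leffler[OF b]])
    moreover have "(- c * s powr b) ^ k / Gamma (b * real k + 1) = (- c) ^ k * ml_term b k s" for k
      by (simp only: ml_term_def power_mult_distrib times_divide_eq_right)
    ultimately show ?thesis unfolding S_def sums_def by simp
  qed
  have meas [measurable]: "ml_term b k \<in> borel_measurable borel" for k
    unfolding ml_term_def by measurable
  have bb: "bounded_borel (\<lambda>s. indicator {0..t} s * ml_term b k s)" for k
    by (rule bounded_borel_continuous)
       (use b Gpos[of k] in \<open>auto simp: ml_term_def intro!: continuous_intros continuous_on_powr'\<close>)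
  have bbS: "bounded_borel (\<lambda>s. indicator {0..t} s * S n s)" for n
  proof (induction n)
    case 0
    then show ?case by (simp add: S_def bounded_borel_const)
  next
    case (Suc n)
    from bounded_borel_add[OF Suc bounded_borel_cmult[OF bb[of n], of "(- c) ^ n"]]
    show ?case by (simp add: S_def algebra_simps)
  qed
  have rlS: "1 + (- c) * rl_integral b (S n) t = S (Suc n) t" for n
  proof (induction n)
    case 0
    show ?case by (simp add: S_def ml_term_def) (simp add: rl_integral_def)
  next
    case (Suc n)
    have "rl_integral b (S (Suc n)) t = rl_integral b (\<lambda>s. indicator {0..t} s * S n s + (- c) ^ n * (indicator {0..t} s * ml_term b n s)) t"
      by (rule rl_integral_cong) (simp add: S_def)
    also have "\<dots> = rl_integral b (S n) t + (- c) ^ n * rl_integral b (ml_term b n) t"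
      using b by (subst rl_integral_add) (auto simp: bbS bb bounded_borel_cmult rl_integral_cmult rl_integral_cutoff simp del: of_bool_eq)
    also have "\<dots> = rl_integral b (S n) t + (- c) ^ n * ml_term b (Suc n) t"
      using b t by (simp add: rl_integral_ml_term)
    finally have "1 + (- c) * rl_integral b (S (Suc n)) t = (1 + (- c) * rl_integral b (S n) t) + (- c) ^ Suc n * ml_term b (Suc n) t"
      by (simp add: algebra_simps)
    also have "\<dots> = S (Suc (Suc n)) t" unfolding Suc by (simp add: S_def)
    finally show ?case .
  qed
  define C where "C = (\<Sum>k. (c * t powr b) ^ k / Gamma (b * real k + 1))"
  have SC: "\<bar>S n s\<bar> \<le> C" if s: "0 \<le> s" "s \<le> t" for n s
  proof -
    have "\<bar>S n s\<bar> \<le> (\<Sum>k<n. \<bar>(- c) ^ k * ml_term b k s\<bar>)" unfolding S_def by (rule sum_abs)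
    also have "\<dots> \<le> (\<Sum>k<n. (c * t powr b) ^ k / Gamma (b * real k + 1))"
    proof (rule sum_mono)
      fix k
      have "\<bar>(- c) ^ k * ml_term b k s\<bar> = (c * s powr b) ^ k / Gamma (b * real k + 1)"
        using Gpos[of k] c by (simp add: ml_term_def abs_mult power_abs power_mult_distrib)
      also have "\<dots> \<le> (c * t powr b) ^ k / Gamma (b * real k + 1)"
        using Gpos[of k] c s b by (intro divide_right_mono power_mono mult_left_mono powr_mono2) auto
      finally show "\<bar>(- c) ^ k * ml_term b k s\<bar> \<le> (c * t powr b) ^ k / Gamma (b * real k + 1)" .
    qed
    also have "\<dots> \<le> C" unfolding C_def
      by (rule sum_le_suminf[OF summable_mittag_leffler[OF b]]) (use Gpos c in \<open>auto simp: less_imp_le\<close>)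
    finally show ?thesis .
  qed
  have C0: "0 \<le> C" using SC[of t 0] t by (simp add: S_def)
  have "(\<lambda>n. rl_integral b (S n) t) \<longlonglongrightarrow> rl_integral b u t"
    unfolding rl_integral_def
  proof (rule integral_dominated_convergence)
    show "integrable lborel (\<lambda>s. C * (rl_kernel b (t - s) * indicator {0..} s))"
      using rl_kernel_mass[OF b, of t 0] by (simp add: has_bochner_integral_iff)
    show "AE s in lborel. (\<lambda>n. rl_kernel b (t - s) * (indicator {0..} s * S n s)) \<longlonglongrightarrow> rl_kernel b (t - s) * (indicator {0..} s * u s)"
      by (intro AE_I2 tendsto_intros Su)
    fix n
    show "(\<lambda>s. rl_kernel b (t - s) * (indicator {0..} s * S n s)) \<in> borel_measurable lborel"
      unfolding S_def by measurable
    show "AE s in lborel. norm (rl_kernel b (t - s) * (indicator {0..} s * S n s)) \<le> C * (rl_kernel b (t - s) * indicator {0..} s)"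
    proof (rule AE_I2)
      fix s
      show "norm (rl_kernel b (t - s) * (indicator {0..} s * S n s)) \<le> C * (rl_kernel b (t - s) * indicator {0..} s)"
      proof (cases "0 \<le> s \<and> s < t")
        case True
        then have "rl_kernel b (t - s) * \<bar>S n s\<bar> \<le> rl_kernel b (t - s) * C"
          using SC[of s n] rl_kernel_nonneg[OF b] by (intro mult_left_mono) auto
        then show ?thesis using True rl_kernel_nonneg[OF b, of "t - s"] by (simp add: abs_mult mult.commute)
      qed (auto simp: rl_kernel_def)
    qed
  next
    show "(\<lambda>s. rl_kernel b (t - s) * (indicator {0..} s * u s)) \<in> borel_measurable lborel"
    proof -
      have "(\<lambda>s. u s) \<in> borel_measurable borel"
        by (rule borel_measurable_LIMSEQ_real[OF Su]) (unfold S_def, measurable)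
      then show ?thesis by measurable
    qed
  qed
  then have "(\<lambda>n. 1 + (- c) * rl_integral b (S n) t) \<longlonglongrightarrow> 1 + (- c) * rl_integral b u t"
    by (intro tendsto_intros)
  then have "(\<lambda>n. S (Suc n) t) \<longlonglongrightarrow> 1 + (- c) * rl_integral b u t" unfolding rlS .
  moreover have "(\<lambda>n. S (Suc n) t) \<longlonglongrightarrow> u t" using Su[of t] by (rule LIMSEQ_Suc)
  ultimately have "u t = 1 + (- c) * rl_integral b u t" by (rule LIMSEQ_unique[symmetric])
  then show ?thesis using rl_integral_cmult[of b "- c" u t] by (simp add: u_def)
qed

section \<open>An algebraically decaying profile\<close>

definition decay_profile :: "real \<Rightarrow> real \<Rightarrow> real \<Rightarrow> real"
  where "decay_profile b K t = (1 + max 0 t / K) powr (- b)"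

text \<open>The negative of the derivative of the decay profile on the positive half-line.\<close>

definition decay_rate :: "real \<Rightarrow> real \<Rightarrow> real \<Rightarrow> real"
  where "decay_rate b K t = b / K * (1 + max 0 t / K) powr (- b - 1)"

lemma profile_base_pos: "0 < K \<Longrightarrow> 0 < 1 + max 0 t / (K::real)"
  by (rule add_pos_nonneg) auto

lemma profile_base_neq: "0 < K \<Longrightarrow> 1 + max 0 t / (K::real) \<noteq> 0"
  using profile_base_pos[of K t] by simp

lemma decay_profile_pos: "0 < K \<Longrightarrow> 0 < decay_profile b K t"
  unfolding decay_profile_def using profile_base_pos[of K t] by simp

lemma decay_profile_nonpos_time: "t \<le> 0 \<Longrightarrow> decay_profile b K t = 1"
  unfolding decay_profile_def by simp

lemma decay_profile_le_1: "0 < b \<Longrightarrow> 0 < K \<Longrightarrow> decay_profile b K t \<le> 1"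
  unfolding decay_profile_def
  using powr_mono2'[of b 1 "1 + max 0 t / K"] by (simp add: powr_minus divide_inverse ge_one_powr_ge_zero inverse_le_1_iff)

lemma continuous_on_decay_profile: "0 < K \<Longrightarrow> continuous_on S (decay_profile b K)"
  unfolding decay_profile_def
  by (intro continuous_on_powr continuous_intros) (meson profile_base_neq | simp)+

lemma continuous_on_decay_rate: "0 < K \<Longrightarrow> continuous_on S (decay_rate b K)"
  unfolding decay_rate_def
  by (intro continuous_on_powr continuous_intros) (meson profile_base_neq | simp)+

lemma decay_rate_nonneg: "0 < b \<Longrightarrow> 0 < K \<Longrightarrow> 0 \<le> decay_rate b K t"
  unfolding decay_rate_def by auto

lemma decay_rate_le:
  assumes "0 < b" "0 < K" "0 \<le> t"
  shows "decay_rate b K t \<le> b / (K + t)"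
proof -
  have "(1 + t / K) powr (- b - 1) \<le> (1 + t / K) powr (- 1)"
    using assms by (intro powr_mono) auto
  also have "\<dots> = K / (K + t)" using assms by (simp add: powr_minus field_simps)
  finally have "b / K * (1 + t / K) powr (- b - 1) \<le> b / K * (K / (K + t))"
    using assms by (intro mult_left_mono) auto
  then show ?thesis using assms by (simp add: decay_rate_def)
qed

lemma rl_integral_decay_rate:
  assumes K: "0 < K" and t: "0 \<le> t"
  shows "rl_integral 1 (decay_rate b K) t = 1 - decay_profile b K t"
proof -
  have "((decay_rate b K) has_integral (- decay_profile b K t - (- decay_profile b K 0))) {0..t}"
  proof (rule fundamental_theorem_of_calculus[OF t])
    fix s assume s: "s \<in> {0..t}"
    have pos: "0 < 1 + s / K" using s K by (auto intro!: add_pos_nonneg)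
    have "((\<lambda>s. - ((1 + s / K) powr (- b))) has_real_derivative decay_rate b K s) (at s within {0..t})"
      using pos s K
      by (auto intro!: derivative_eq_intros simp: decay_rate_def)
    then have "((\<lambda>s. - decay_profile b K s) has_real_derivative decay_rate b K s) (at s within {0..t})"
      by (rule has_field_derivative_transform_within[where d=1]) (use s in \<open>auto simp: decay_profile_def\<close>)
    then show "((\<lambda>s. - decay_profile b K s) has_vector_derivative decay_rate b K s) (at s within {0..t})"
      by (simp add: has_real_derivative_iff_has_vector_derivative)
  qed
  then have "integral {0..t} (decay_rate b K) = 1 - decay_profile b K t"
    by (simp add: integral_unique decay_profile_nonpos_time)
  then show ?thesis using rl_integral_one[OF continuous_on_decay_rate[OF K]] by simp
qed

lemma continuous_on_frac_decay_rate:
  assumes a: "0 < a" "a \<le> 1" and K: "0 < K"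
  shows "continuous_on {0..T} (frac_integral (1 - a) (decay_rate b K))"
proof (cases "a = 1")
  case True
  then show ?thesis using continuous_on_decay_rate[OF K] by (simp add: frac_integral_def[abs_def])
next
  case False
  then have "frac_integral (1 - a) (decay_rate b K) = rl_integral (1 - a) (decay_rate b K)"
    using frac_integral_eq_rl_integral[of "1 - a"] by auto
  then show ?thesis using continuous_on_rl_integral[OF _ _ continuous_on_decay_rate[OF K]] a False by simp
qed

text \<open>This is the Volterra form of the identity \<open>D\<^sup>a w = - I\<^sup>1\<^sup>-\<^sup>a h\<close> with \<open>h = - w'\<close>, so that all estimates of
Caputo derivatives of the profile reduce to a fractional integral of a positive function.\<close>

lemma decay_profile_volterra:
  assumes a: "0 < a" "a \<le> 1" and K: "0 < K" and t: "0 \<le> t"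
  shows "decay_profile b K t = 1 - rl_integral a (frac_integral (1 - a) (decay_rate b K)) t"
proof (cases "a = 1")
  case True
  then show ?thesis using rl_integral_decay_rate[OF K t] by (simp add: frac_integral_def[abs_def])
next
  case False
  then have "frac_integral (1 - a) (decay_rate b K) = rl_integral (1 - a) (decay_rate b K)"
    using frac_integral_eq_rl_integral[of "1 - a"] by auto
  moreover have "rl_integral a (rl_integral (1 - a) (decay_rate b K)) t = rl_integral 1 (decay_rate b K) t"
    using rl_integral_semigroup_continuous[OF a(1) _ continuous_on_decay_rate[OF K], of "1 - a" t t b] a False by simp
  ultimately show ?thesis using rl_integral_decay_rate[OF K t] by simp
qed

text \<open>In \<open>\<integral> (t - s)\<^sup>-\<^sup>a h(s) ds\<close> the two distances satisfy \<open>(t - s) + (K + s) = K + t\<close>, so one of them is at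
least \<open>(K + t)/2\<close>. In the first case the kernel is small and the mass of \<open>h\<close> is at most 1; in the
second case \<open>h(s) \<le> b/(K + s)\<close> is small. The constant does not depend on \<open>K\<close>, which is what makes a
large \<open>K\<close> useful.\<close>

lemma frac_decay_rate_le:
  assumes a: "0 < a" "a \<le> 1" and b: "0 < b"
  obtains C where "0 < C" "\<And>K t. 0 < K \<Longrightarrow> 0 \<le> t \<Longrightarrow> frac_integral (1 - a) (decay_rate b K) t \<le> C * (K + t) powr (- a)"
proof (cases "a = 1")
  case True
  have "frac_integral (1 - a) (decay_rate b K) t \<le> b * (K + t) powr (- a)" if "0 < K" "0 \<le> t" for K t
    using decay_rate_le[OF b that] that True by (simp add: frac_integral_def powr_minus divide_inverse)
  then show thesis using that b by blast
next
  case False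
  with a have a1: "0 < 1 - a" by simp
  have G1: "Gamma (1 - a) > 0" and G2: "Gamma (1 - a + 1) > 0" using a1 by (auto intro!: Gamma_real_pos)
  define C where "C = 2 / Gamma (1 - a) + 2 * b / Gamma (1 - a + 1)"
  have C: "0 < C" unfolding C_def using G1 G2 b by (intro add_pos_pos divide_pos_pos) auto
  have "frac_integral (1 - a) (decay_rate b K) t \<le> C * (K + t) powr (- a)" if K: "0 < K" and t: "0 \<le> t" for K t
  proof -
    let ?h = "\<lambda>s. indicator {0..t} s * decay_rate b K s"
    have hb: "bounded_borel ?h" by (rule bounded_borel_continuous[OF continuous_on_decay_rate[OF K]])
    define A where "A = ((K + t) / 2) powr (- a) / Gamma (1 - a)"
    define B where "B = 2 * b / (K + t)"
    let ?f = "\<lambda>s. rl_kernel (1 - a) (t - s) * (indicator {0..} s * ?h s)"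
    let ?g = "\<lambda>s. A * (rl_kernel 1 (t - s) * (indicator {0..} s * ?h s)) + B * (rl_kernel (1 - a) (t - s) * indicator {0..} s)"
    have AB: "0 \<le> A" "0 \<le> B" using G1 K t b by (auto simp: A_def B_def)
    have le: "?f s \<le> ?g s" for s
    proof (cases "0 \<le> s \<and> s < t")
      case True
      have h0: "0 \<le> decay_rate b K s" by (rule decay_rate_nonneg[OF b K])
      have k0: "0 \<le> rl_kernel (1 - a) (t - s)" by (rule rl_kernel_nonneg[OF a1])
      have "rl_kernel (1 - a) (t - s) * decay_rate b K s \<le> A * decay_rate b K s + B * rl_kernel (1 - a) (t - s)"
      proof (cases "(K + t) / 2 \<le> t - s")
        case True
        have "rl_kernel (1 - a) (t - s) = (t - s) powr (- a) / Gamma (1 - a)"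
          using \<open>0 \<le> s \<and> s < t\<close> by (simp add: rl_kernel_def)
        also have "\<dots> \<le> A" unfolding A_def
          using True a K t G1 by (intro divide_right_mono powr_mono2') auto
        finally have "rl_kernel (1 - a) (t - s) * decay_rate b K s \<le> A * decay_rate b K s"
          using h0 by (intro mult_right_mono) auto
        moreover have "0 \<le> B * rl_kernel (1 - a) (t - s)" using AB k0 by simp
        ultimately show ?thesis by linarith
      next
        case False
        then have "(K + t) / 2 \<le> K + s" by (simp add: field_simps)
        then have "b / (K + s) \<le> b / ((K + t) / 2)"
          using b K t by (intro divide_left_mono) auto
        also have "b / ((K + t) / 2) = B" by (simp add: B_def)
        finally have "decay_rate b K s \<le> B"
          using decay_rate_le[OF b K, of s] True by linarith
        then have "rl_kernel (1 - a) (t - s) * decay_rate b K s \<le> rl_kernel (1 - a) (t - s) * B"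
          using k0 by (rule mult_left_mono)
        moreover have "0 \<le> A * decay_rate b K s" using AB h0 by simp
        ultimately show ?thesis by (simp add: mult.commute)
      qed
      then show ?thesis using True by (simp add: rl_kernel_one)
    next
      case False
      then have "?f s = 0" "?g s = 0" by (auto simp: rl_kernel_def)
      then show ?thesis by (simp only: order_refl)
    qed
    have g: "has_bochner_integral lborel ?g (A * rl_integral 1 ?h t + B * ((max 0 (t - 0)) powr (1 - a) / Gamma (1 - a + 1)))"
      unfolding rl_integral_def
      by (intro has_bochner_integral_add has_bochner_integral_mult_right has_bochner_integral_integrable
            rl_kernel_mass bounded_borel_integrable hb a1) auto
    have "frac_integral (1 - a) (decay_rate b K) t = rl_integral (1 - a) ?h t"
      using frac_integral_eq_rl_integral[of "1 - a"] False by (simp add: rl_integral_cutoff)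
    also have "\<dots> \<le> (\<integral>s. ?g s \<partial>lborel)"
      unfolding rl_integral_def
      by (rule integral_mono) (use g le bounded_borel_integrable[OF a1 hb] in \<open>auto simp: has_bochner_integral_iff\<close>)
    also have "\<dots> = A * (1 - decay_profile b K t) + B * t powr (1 - a) / Gamma (1 - a + 1)"
      using has_bochner_integral_integral_eq[OF g] rl_integral_decay_rate[OF K t] t by (simp add: rl_integral_cutoff)
    also have "\<dots> \<le> A * 1 + B * (K + t) powr (1 - a) / Gamma (1 - a + 1)"
      using AB G2 a1 K t decay_profile_pos[OF K, of b t]
      by (intro add_mono mult_left_mono divide_right_mono powr_mono2) auto
    also have "A \<le> 2 / Gamma (1 - a) * (K + t) powr (- a)"
    proof -
      have "((K + t) / 2) powr (- a) = (K + t) powr (- a) * 2 powr a"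
        using K t by (simp add: powr_divide powr_minus_divide)
      also have "\<dots> \<le> (K + t) powr (- a) * 2"
        using powr_mono[of a 1 2] a by (intro mult_left_mono) auto
      finally have "A \<le> (K + t) powr (- a) * 2 / Gamma (1 - a)"
        unfolding A_def using G1 by (intro divide_right_mono) auto
      also have "\<dots> = 2 / Gamma (1 - a) * (K + t) powr (- a)" by simp
      finally show ?thesis .
    qed
    also have "B * (K + t) powr (1 - a) / Gamma (1 - a + 1) = 2 * b / Gamma (1 - a + 1) * (K + t) powr (- a)"
    proof -
      have "(K + t) powr (1 - a) = (K + t) * (K + t) powr (- a)"
        using K t powr_mult_base[of "K + t" "- a"] by simp
      then show ?thesis unfolding B_def using K t by simp
    qed
    finally show ?thesis by (simp add: C_def algebra_simps)
  qed
  then show thesis using that C by blast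
qed

text \<open>The kernel is at least its value at the greatest distance \<open>t\<close>.\<close>

lemma frac_decay_rate_ge:
  assumes a: "0 < a" "a < 1" and b: "0 < b" and K: "0 < K" and t: "0 < t"
  shows "t powr (- a) / Gamma (1 - a) * (1 - decay_profile b K t) \<le> frac_integral (1 - a) (decay_rate b K) t"
proof -
  have a1: "0 < 1 - a" using a by simp
  let ?h = "\<lambda>s. indicator {0..t} s * decay_rate b K s"
  have hb: "bounded_borel ?h" by (rule bounded_borel_continuous[OF continuous_on_decay_rate[OF K]])
  let ?A = "t powr (- a) / Gamma (1 - a)"
  have "?A * rl_integral 1 ?h t = (\<integral>s. ?A * (rl_kernel 1 (t - s) * (indicator {0..} s * ?h s)) \<partial>lborel)"
    unfolding rl_integral_def by simp
  also have "\<dots> \<le> rl_integral (1 - a) ?h t"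
    unfolding rl_integral_def
  proof (rule integral_mono)
    fix s
    show "?A * (rl_kernel 1 (t - s) * (indicator {0..} s * ?h s)) \<le> rl_kernel (1 - a) (t - s) * (indicator {0..} s * ?h s)"
    proof (cases "0 \<le> s \<and> s < t")
      case True
      then have "?A \<le> rl_kernel (1 - a) (t - s)"
        using a Gamma_real_pos[OF a1] by (auto simp: rl_kernel_def intro!: divide_right_mono powr_mono2')
      then have "?A * decay_rate b K s \<le> rl_kernel (1 - a) (t - s) * decay_rate b K s"
        using decay_rate_nonneg[OF b K, of s] by (rule mult_right_mono)
      then show ?thesis using True by (simp add: rl_kernel_one)
    qed (auto simp: rl_kernel_def)
  qed (use bounded_borel_integrable[OF a1 hb] bounded_borel_integrable[OF _ hb, of 1] in auto)
  finally show ?thesis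
    using rl_integral_decay_rate[OF K, of t b] t a1 frac_integral_eq_rl_integral[of "1 - a"]
    by (simp add: rl_integral_cutoff)
qed

text \<open>The function \<open>u(t) = E\<^sub>b(- c t\<^sup>b)\<close> solves \<open>D\<^sup>b u = - c u\<close>, while \<open>D\<^sup>b w \<le> - c' w\<close> is ensured only from
time \<open>K\<close> on, since the Caputo derivative of the smooth profile vanishes at 0. The factor \<open>1/2\<close> makes
room: by continuity \<open>u \<ge> 1/2\<close> up to time \<open>K\<close> when \<open>c\<close> is small, so the sign condition of the
maximum principle for \<open>u - w/2\<close> has to be checked only after time \<open>K\<close>.\<close>

lemma mittag_leffler_ge_decay_profile:
  assumes b: "0 < b" "b < 1" and K: "0 < K"
  obtains c where "0 < c" "\<And>t. 0 \<le> t \<Longrightarrow> decay_profile b K t / 2 \<le> mittag_leffler b (- c * t powr b)"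
proof -
  have b1: "0 < 1 - b" using b by simp
  have G: "Gamma (1 - b) > 0" by (rule Gamma_real_pos[OF b1])
  obtain d where d: "0 < d" "\<And>x. \<bar>x\<bar> < d \<Longrightarrow> \<bar>mittag_leffler b x - 1\<bar> < 1 / 2"
    using isCont_mittag_leffler[OF b(1), of 0, unfolded continuous_at_eps_delta, rule_format, of "1/2"]
    by (auto simp: mittag_leffler_0 dist_real_def)
  \<comment> \<open>For \<open>s \<ge> K\<close> the profile is at most \<open>2\<close> to the power \<open>-b\<close>, and \<open>s\<close> to the power \<open>-b\<close> is at
    least \<open>K\<close> to the power \<open>-b\<close> times the profile.\<close>
  define c' where "c' = K powr (- b) * (1 - 2 powr (- b)) / Gamma (1 - b)"
  have "2 powr (- b) < 2 powr 0" using b by (intro powr_less_mono) auto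
  then have c': "0 < c'" unfolding c'_def using K G by (intro divide_pos_pos mult_pos_pos) auto
  define c where "c = min c' (d / (2 * K powr b))"
  have c: "0 < c" "c \<le> c'" using c' d K by (auto simp: c_def)
  let ?u = "\<lambda>t. mittag_leffler b (- c * t powr b)"
  let ?w = "decay_profile b K"
  let ?G = "frac_integral (1 - b) (decay_rate b K)"
  have early: "1 / 2 \<le> ?u t" if "0 \<le> t" "t \<le> K" for t
  proof -
    have "c * t powr b \<le> d / (2 * K powr b) * K powr b"
      using that K b d by (intro mult_mono powr_mono2) (auto simp: c_def)
    also have "\<dots> = d / 2" using K by simp
    finally have "\<bar>- c * t powr b\<bar> < d" using c d by (simp add: abs_mult)
    from d(2)[OF this] show ?thesis by linarith
  qed
  have "?w t / 2 \<le> ?u t" if t: "0 \<le> t" for t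
  proof -
    let ?F = "\<lambda>s. - c * ?u s + 1 / 2 * ?G s"
    have uc: "continuous_on {0..t} ?u"
      by (rule continuous_on_subset[OF continuous_on_mittag_leffler_powr[OF b(1)]]) auto
    have Gc: "continuous_on {0..t} ?G" by (rule continuous_on_frac_decay_rate) (use b K in auto)
    have "0 \<le> ?u t - ?w t / 2"
    proof (rule volterra_weak_maximum_principle[of b t ?F "\<lambda>s. ?u s - ?w s / 2" "1 / 2"])
      show "continuous_on {0..t} ?F" using uc Gc by (intro continuous_intros)
      fix s assume s: "0 \<le> s" "s \<le> t"
      let ?I = "\<lambda>x. indicator {0..t} x :: real"
      have "rl_integral b ?F s = rl_integral b (\<lambda>x. - c * (?I x * ?u x) + 1 / 2 * (?I x * ?G x)) s"
        by (rule rl_integral_cong) (use s in simp)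
      also have "\<dots> = rl_integral b (\<lambda>x. - c * (?I x * ?u x)) s + rl_integral b (\<lambda>x. 1 / 2 * (?I x * ?G x)) s"
        by (intro rl_integral_add bounded_borel_cmult bounded_borel_continuous uc Gc b)
      also have "\<dots> = - c * rl_integral b ?u s + 1 / 2 * rl_integral b ?G s"
        unfolding rl_integral_cmult using s by (simp add: rl_integral_cutoff)
      finally have F: "rl_integral b ?F s = - c * rl_integral b ?u s + 1 / 2 * rl_integral b ?G s" .
      have "?u s = 1 + (- c) * rl_integral b ?u s"
        using mittag_leffler_volterra[OF b(1) c(1) s(1)] unfolding rl_integral_cmult .
      moreover have "?w s = 1 - rl_integral b ?G s"
        by (rule decay_profile_volterra) (use b K s in auto)
      ultimately show "?u s - ?w s / 2 = 1 / 2 + rl_integral b ?F s"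
        unfolding F by linarith
    next
      fix s assume s: "0 < s" "s \<le> t" and neg: "?u s - ?w s / 2 < 0"
      have sK: "K < s"
      proof (rule ccontr)
        assume "\<not> K < s"
        then have "1 / 2 \<le> ?u s" using early s by simp
        then show False using neg decay_profile_le_1[OF b(1) K, of s] by simp
      qed
      have w2: "?w s \<le> 2 powr (- b)" using sK K b s by (auto simp: decay_profile_def intro!: powr_mono2')
      have ws: "?w s \<le> K powr b * s powr (- b)"
      proof -
        have "?w s \<le> (s / K) powr (- b)" unfolding decay_profile_def using s K b by (intro powr_mono2') auto
        also have "\<dots> = K powr b * s powr (- b)" using s K by (simp add: powr_divide powr_minus_divide)
        finally show ?thesis .
      qed
      have "c' * ?w s \<le> c' * (K powr b * s powr (- b))" using c' ws by (intro mult_left_mono) auto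
      also have "\<dots> = s powr (- b) / Gamma (1 - b) * (1 - 2 powr (- b))"
        using K by (simp add: c'_def powr_minus)
      also have "\<dots> \<le> s powr (- b) / Gamma (1 - b) * (1 - ?w s)"
        using w2 G by (intro mult_left_mono) auto
      also have "\<dots> \<le> ?G s" by (rule frac_decay_rate_ge) (use b K s in auto)
      finally have Gs: "c' * ?w s \<le> ?G s" .
      have "c * ?u s \<le> c * (?w s / 2)" using neg c by (intro mult_left_mono) auto
      also have "\<dots> \<le> c' * (?w s / 2)" using c decay_profile_pos[OF K, of b s] by (intro mult_right_mono) auto
      finally show "0 \<le> ?F s" using Gs by simp
    qed (use b t in auto)
    then show ?thesis by simp
  qed
  then show thesis using that c by blast
qed

section \<open>Homogeneous and cooperative vector fields\<close>

lemma homogeneous_at_zero: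
  assumes "homogeneous p h" "1 \<le> p"
  shows "h 0 = 0"
proof -
  have "h (2 *\<^sub>R 0) = (2 powr p) *\<^sub>R h 0"
    using assms(1) unfolding homogeneous_def by (meson zero_less_numeral)
  then have "(2 powr p - 1) *\<^sub>R h 0 = 0" by (simp add: algebra_simps)
  moreover have "(2::real) powr 1 \<le> 2 powr p" using assms(2) by (intro powr_mono) auto
  then have "(2::real) \<le> 2 powr p" by simp
  then have "2 powr p - 1 \<noteq> (0::real)" by linarith
  ultimately show ?thesis by (metis scaleR_eq_0_iff)
qed

text \<open>The derivative may fail to exist at 0. By scaling it suffices to consider a point \<open>x\<close> of the unit
sphere and a point \<open>y\<close> of the unit ball. If they are close, the segment between them stays in an
annulus on which the Jacobian is bounded; otherwise boundedness of \<open>h\<close> is enough. Scaling back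
gives a factor \<open>norm x\<close> to the power \<open>p - 1\<close>, which is bounded on the ball because \<open>p \<ge> 1\<close>.\<close>

lemma homogeneous_lipschitz_on_ball:
  fixes h :: "real ^ 'd \<Rightarrow> real ^ 'd"
  assumes cont: "continuous_on UNIV h" and C1: "continuously_differentiable_on h (UNIV - {0})"
    and hom: "homogeneous p h" and p: "1 \<le> p"
  obtains L where "0 \<le> L" "\<And>x y. norm x \<le> R \<Longrightarrow> norm y \<le> R \<Longrightarrow> norm (h x - h y) \<le> L * norm (x - y)"
proof -
  define A where "A = cball (0::real^'d) 1 - ball 0 (1/2)"
  have "compact A" unfolding A_def by (intro compact_diff) auto
  have A0: "z \<noteq> 0" if "z \<in> A" for z using that by (auto simp: A_def)
  have "continuous_on A (\<lambda>x. jacobian h (at x))"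
    using C1 A0 unfolding continuously_differentiable_on_def by (auto intro: continuous_on_subset)
  then have "bounded ((\<lambda>x. jacobian h (at x)) ` A)"
    using compact_continuous_image[OF _ \<open>compact A\<close>] compact_imp_bounded by blast
  then obtain B where B: "\<And>x. x \<in> A \<Longrightarrow> norm (jacobian h (at x)) \<le> B"
    unfolding bounded_iff by blast
  define L1 where "L1 = real (CARD('d)) * real (CARD('d)) * \<bar>B\<bar>"
  have J: "(h has_derivative (\<lambda>v. jacobian h (at x) *v v)) (at x)" if "x \<noteq> 0" for x
    using C1 that unfolding continuously_differentiable_on_def by (auto simp: jacobian_works[symmetric])
  have on: "onorm (\<lambda>v. jacobian h (at x) *v v) \<le> L1" if "x \<in> A" for x
    unfolding L1_def
  proof (rule onorm_le_matrix_component)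
    fix i j
    have "\<bar>jacobian h (at x) $ i $ j\<bar> \<le> norm (jacobian h (at x) $ i)" by (rule component_le_norm_cart)
    also have "\<dots> \<le> norm (jacobian h (at x))" by (rule Finite_Cartesian_Product.norm_nth_le)
    also have "\<dots> \<le> \<bar>B\<bar>" using B[OF that] by linarith
    finally show "\<bar>jacobian h (at x) $ i $ j\<bar> \<le> \<bar>B\<bar>" .
  qed
  have "bounded (h ` cball 0 1)"
    using compact_continuous_image[OF continuous_on_subset[OF cont] compact_cball] compact_imp_bounded by blast
  then obtain M where "\<forall>x\<in>cball 0 1. norm (h x) \<le> M" unfolding bounded_iff by auto
  then have M: "\<And>x. norm x \<le> 1 \<Longrightarrow> norm (h x) \<le> M" by simp
  have M0: "0 \<le> M" using M[of 0] norm_ge_zero[of "h 0"] by (simp del: norm_ge_zero)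
  define L0 where "L0 = max L1 (4 * M)"
  have L0: "0 \<le> L0" using M0 by (simp add: L0_def)
  have unit: "norm (h x - h y) \<le> L0 * norm (x - y)" if x: "norm x = 1" and y: "norm y \<le> 1" for x y
  proof (cases "norm (x - y) < 1/2")
    case True
    have seg: "z \<in> A" if z: "z \<in> closed_segment x y" for z
    proof -
      have "z \<in> cball 0 1"
        using closed_segment_subset[of x "cball 0 1" y] x y z by auto
      moreover have "norm (z - x) \<le> norm (y - x)" using segment_bound(1)[OF z] .
      then have "1/2 \<le> norm z"
        using True x norm_triangle_ineq2[of x z] by (simp add: norm_minus_commute)
      ultimately show ?thesis by (auto simp: A_def)
    qed
    have "norm (h x - h y) \<le> L1 * norm (x - y)"
    proof (rule differentiable_bound[of "closed_segment x y"])
      fix z assume "z \<in> closed_segment x y"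
      then have zA: "z \<in> A" by (rule seg)
      show "(h has_derivative (\<lambda>v. jacobian h (at z) *v v)) (at z within closed_segment x y)"
        using J[OF A0[OF zA]] by (rule has_derivative_at_withinI)
      show "onorm (\<lambda>v. jacobian h (at z) *v v) \<le> L1" using on[OF zA] .
    qed auto
    also have "\<dots> \<le> L0 * norm (x - y)" by (intro mult_right_mono) (auto simp: L0_def)
    finally show ?thesis .
  next
    case False
    have "norm (h x - h y) \<le> M + M" using M[of x] M[of y] x y norm_triangle_ineq4[of "h x" "h y"] by simp
    also have "\<dots> = 4 * M * (1/2)" by simp
    also have "\<dots> \<le> L0 * norm (x - y)" using False M0 L0 by (intro mult_mono) (auto simp: L0_def)
    finally show ?thesis .
  qed
  define L where "L = (max 0 R) powr (p - 1) * L0"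
  have L: "0 \<le> L" using L0 by (simp add: L_def)
  have half: "norm (h x - h y) \<le> L * norm (x - y)" if x: "norm x \<le> R" and yx: "norm y \<le> norm x" for x y
  proof (cases "x = 0")
    case True
    then show ?thesis using yx by simp
  next
    case False
    define r where "r = norm x"
    have r: "0 < r" using False by (simp add: r_def)
    have sc: "h z = r powr p *\<^sub>R h (z /\<^sub>R r)" for z
      using hom r unfolding homogeneous_def by (metis divideR_right less_irrefl scaleR_scaleR right_inverse scaleR_one)
    have "norm (h x - h y) = r powr p * norm (h (x /\<^sub>R r) - h (y /\<^sub>R r))"
      by (subst (1 2) sc) (simp add: scaleR_diff_right[symmetric])
    also have "\<dots> \<le> r powr p * (L0 * norm (x /\<^sub>R r - y /\<^sub>R r))"
      using r yx by (intro mult_left_mono unit) (auto simp: r_def divide_simps)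
    also have "norm (x /\<^sub>R r - y /\<^sub>R r) = norm (x - y) / r"
      using r by (simp add: scaleR_diff_right[symmetric] divide_inverse mult.commute)
    also have "r powr p * (L0 * (norm (x - y) / r)) = r powr (p - 1) * L0 * norm (x - y)"
      using r by (simp add: powr_diff)
    also have "\<dots> \<le> L * norm (x - y)"
      unfolding L_def using p x r L0 by (intro mult_right_mono powr_mono2) (auto simp: r_def)
    finally show ?thesis .
  qed
  have "norm (h x - h y) \<le> L * norm (x - y)" if "norm x \<le> R" "norm y \<le> R" for x y
    using half[of x y] half[of y x] that by (cases "norm y \<le> norm x") (auto simp: norm_minus_commute)
  then show thesis using that L by blast
qed

text \<open>The \<open>i\<close>-th component is nondecreasing along the segment from \<open>x\<close> to \<open>y\<close>, as the Metzler property
gives its derivative a sign. The segment meets 0 at most at its starting point, where continuity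
suffices.\<close>

lemma cooperative_quasimonotone:
  fixes f :: "real ^ 'd \<Rightarrow> real ^ 'd"
  assumes f: "cooperative f" and x: "0 \<le> x" "x \<le> y" and i: "x $ i = y $ i"
  shows "f x $ i \<le> f y $ i"
proof (cases "x = y")
  case False
  define v where "v = y - x"
  have v: "0 \<le> v" "v \<noteq> 0" "v $ i = 0" using x i False by (auto simp: v_def)
  define c where "c = (\<lambda>s. f (x + s *\<^sub>R v) $ i)"
  have "c 0 \<le> c 1"
  proof (rule DERIV_nonneg_imp_increasing_open[where a=0 and b=1 and f=c])
    fix s :: real assume s: "0 < s" "s < 1"
    define z where "z = x + s *\<^sub>R v"
    have sv: "0 \<le> s *\<^sub>R v" using s v by (auto simp: less_eq_vec_def)
    have z: "0 \<le> z" using x sv by (simp add: z_def add_nonneg_nonneg)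
    have "z \<noteq> 0"
    proof
      assume "z = 0"
      then have "s *\<^sub>R v = 0" using x(1) sv unfolding z_def by (metis add_nonneg_eq_0_iff)
      then show False using s v by simp
    qed
    then have D: "(f has_derivative (\<lambda>u. jacobian f (at z) *v u)) (at z)" and M: "metzler (jacobian f (at z))"
      using f z unfolding cooperative_def continuously_differentiable_on_def
      by (auto simp: jacobian_works[symmetric] nonneg_orthant_def)
    have "((\<lambda>s. x + s *\<^sub>R v) has_derivative (\<lambda>d. d *\<^sub>R v)) (at s)"
      by (auto intro!: derivative_eq_intros)
    then have "((\<lambda>s. f (x + s *\<^sub>R v)) has_derivative (\<lambda>d. jacobian f (at z) *v (d *\<^sub>R v))) (at s)"
      using D unfolding z_def by (rule has_derivative_compose)
    then have "(c has_derivative (\<lambda>d. (jacobian f (at z) *v (d *\<^sub>R v)) $ i)) (at s)"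
      unfolding c_def by (rule bounded_linear.has_derivative[OF bounded_linear_vec_nth])
    then have "(c has_real_derivative (jacobian f (at z) *v v) $ i) (at s)"
      unfolding has_field_derivative_def
      by (simp add: matrix_vector_mult_scaleR mult_commute_abs)
    moreover have "0 \<le> (jacobian f (at z) *v v) $ i"
      unfolding matrix_vector_mult_def
    proof (simp, rule sum_nonneg)
      fix j
      show "0 \<le> jacobian f (at z) $ i $ j * v $ j"
        using M v(1,3) unfolding metzler_def by (cases "j = i") (auto simp: less_eq_vec_def intro!: mult_nonneg_nonneg)
    qed
    ultimately show "\<exists>y. (c has_real_derivative y) (at s) \<and> 0 \<le> y" by blast
  next
    have "continuous_on UNIV f" using f by (simp add: cooperative_def)
    then have "continuous_on {0..1} (\<lambda>s. f (x + s *\<^sub>R v))"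
      by (rule continuous_on_compose2) (auto intro!: continuous_intros)
    then show "continuous_on {0..1} c" unfolding c_def by (rule continuous_on_component)
  qed simp
  then show ?thesis by (simp add: c_def v_def)
qed simp

section \<open>Cooperative delay systems\<close>

text \<open>The nearest point of the order interval between 0 and \<open>u\<close>, for \<open>u \<ge> 0\<close>.\<close>

definition trunc_below :: "real ^ 'd \<Rightarrow> real ^ 'd \<Rightarrow> real ^ 'd"
  where "trunc_below u x = (\<chi> i. max 0 (min (x $ i) (u $ i)))"

lemma trunc_below_bounds: "0 \<le> u \<Longrightarrow> 0 \<le> trunc_below u x \<and> trunc_below u x \<le> u"
  by (auto simp: trunc_below_def less_eq_vec_def)

lemma trunc_below_id: "0 \<le> x \<Longrightarrow> x \<le> u \<Longrightarrow> trunc_below u x = x"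
  by (auto simp: trunc_below_def less_eq_vec_def vec_eq_iff max_def min_def)

lemma trunc_below_contracts: "norm (trunc_below u x - trunc_below u y) \<le> norm (x - y)"
  by (rule norm_le_componentwise_cart) (auto simp: trunc_below_def)

lemma continuous_on_trunc_below:
  "continuous_on S u \<Longrightarrow> continuous_on S x \<Longrightarrow> continuous_on S (\<lambda>t. trunc_below (u t) (x t))"
  unfolding trunc_below_def
  by (intro continuous_on_vec_lambda continuous_intros)

lemma norm_mono_nonneg: "0 \<le> x \<Longrightarrow> x \<le> y \<Longrightarrow> norm x \<le> norm (y :: real ^ 'd)"
  by (rule norm_le_componentwise_cart) (auto simp: less_eq_vec_def intro: order_trans)

locale cooperative_delay_system =
  fixes m :: nat and \<alpha> :: "real ^ 'd" and \<rho> :: real and \<tau> :: "nat \<Rightarrow> real \<Rightarrow> real"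
    and f :: "real ^ 'd \<Rightarrow> real ^ 'd" and g :: "nat \<Rightarrow> real ^ 'd \<Rightarrow> real ^ 'd"
    and p :: real and q :: "nat \<Rightarrow> real"
  assumes order: "\<And>i. 0 < \<alpha> $ i \<and> \<alpha> $ i \<le> 1"
    and \<rho>_nonneg: "0 \<le> \<rho>"
    and delay_continuous: "\<And>j. j \<in> {1..m} \<Longrightarrow> continuous_on {0..} (\<tau> j)"
    and delay_range: "\<And>j t. j \<in> {1..m} \<Longrightarrow> 0 \<le> t \<Longrightarrow> 0 \<le> \<tau> j t \<and> \<tau> j t \<le> \<rho>"
    and f_cooperative: "cooperative f"
    and p_ge_1: "1 \<le> p"
    and f_homogeneous: "homogeneous p f"
    and g_continuous: "\<And>j. j \<in> {1..m} \<Longrightarrow> continuous_on UNIV (g j)"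
    and g_C1: "\<And>j. j \<in> {1..m} \<Longrightarrow> continuously_differentiable_on (g j) (UNIV - {0})"
    and g_order_preserving: "\<And>j. j \<in> {1..m} \<Longrightarrow> order_preserving (g j)"
    and q_ge_p: "\<And>j. j \<in> {1..m} \<Longrightarrow> p \<le> q j"
    and g_homogeneous: "\<And>j. j \<in> {1..m} \<Longrightarrow> homogeneous (q j) (g j)"
begin

lemma f_continuous: "continuous_on UNIV f"
  using f_cooperative by (simp add: cooperative_def)

lemma f_0: "f 0 = 0"
  by (rule homogeneous_at_zero[OF f_homogeneous p_ge_1])

lemma g_0: "j \<in> {1..m} \<Longrightarrow> g j 0 = 0"
  by (rule homogeneous_at_zero[OF g_homogeneous order_trans[OF p_ge_1 q_ge_p]])

lemma g_mono: "j \<in> {1..m} \<Longrightarrow> 0 \<le> x \<Longrightarrow> x \<le> y \<Longrightarrow> g j x \<le> g j y"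
  using g_order_preserving[of j] order_trans[of 0 x y]
  unfolding order_preserving_def nonneg_orthant_def by (auto intro: mono_onD)

lemma fields_lipschitz:
  obtains Lf Lg where "0 \<le> Lf" "\<And>j. 0 \<le> Lg j"
    "\<And>x y. norm x \<le> R \<Longrightarrow> norm y \<le> R \<Longrightarrow> norm (f x - f y) \<le> Lf * norm (x - y)"
    "\<And>j x y. j \<in> {1..m} \<Longrightarrow> norm x \<le> R \<Longrightarrow> norm y \<le> R \<Longrightarrow> norm (g j x - g j y) \<le> Lg j * norm (x - y)"
proof -
  obtain Lf where Lf: "0 \<le> Lf" "\<And>x y. norm x \<le> R \<Longrightarrow> norm y \<le> R \<Longrightarrow> norm (f x - f y) \<le> Lf * norm (x - y)"
    using homogeneous_lipschitz_on_ball[of f p R] f_cooperative f_homogeneous p_ge_1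
    unfolding cooperative_def by blast
  have "\<exists>L\<ge>0. j \<in> {1..m} \<longrightarrow> (\<forall>x y. norm x \<le> R \<longrightarrow> norm y \<le> R \<longrightarrow> norm (g j x - g j y) \<le> L * norm (x - y))" for j
  proof (cases "j \<in> {1..m}")
    case True
    obtain L where "0 \<le> L" "\<And>x y. norm x \<le> R \<Longrightarrow> norm y \<le> R \<Longrightarrow> norm (g j x - g j y) \<le> L * norm (x - y)"
      using homogeneous_lipschitz_on_ball[OF g_continuous[OF True] g_C1[OF True] g_homogeneous[OF True]
          order_trans[OF p_ge_1 q_ge_p[OF True]], of R] by blast
    then show ?thesis by blast
  qed auto
  then obtain Lg where "\<And>j. 0 \<le> Lg j"
    "\<And>j x y. j \<in> {1..m} \<Longrightarrow> norm x \<le> R \<Longrightarrow> norm y \<le> R \<Longrightarrow> norm (g j x - g j y) \<le> Lg j * norm (x - y)"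
    by metis
  with Lf show thesis using that by blast
qed

definition rhs :: "(real \<Rightarrow> real ^ 'd) \<Rightarrow> real \<Rightarrow> real ^ 'd"
  where "rhs x t = f (x t) + (\<Sum>j=1..m. g j (x (t - \<tau> j t)))"

lemma continuous_on_rhs:
  assumes x: "continuous_on {- \<rho>..S} x"
  shows "continuous_on {0..S} (rhs x)"
proof -
  have "continuous_on {0..S} (\<lambda>t. x (t - \<tau> j t))" if j: "j \<in> {1..m}" for j
    by (rule continuous_on_compose2[OF x])
       (use delay_range[OF j] in \<open>force intro!: continuous_intros continuous_on_subset[OF delay_continuous[OF j]]\<close>)+
  moreover have "continuous_on {0..S} x" using x by (rule continuous_on_subset) (use \<rho>_nonneg in auto)
  ultimately show ?thesis
    unfolding rhs_def
    by (intro continuous_intros continuous_on_compose2[OF f_continuous] continuous_on_compose2[OF g_continuous]) auto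
qed

text \<open>On a compact time interval both solutions lie in a ball, where the vector fields are Lipschitz.\<close>

lemma solutions_agree:
  assumes x: "continuous_on {- \<rho>..<S} x" "\<And>t. 0 < t \<Longrightarrow> t < S \<Longrightarrow> has_caputo_derivative_vec \<alpha> x (rhs x t) t"
    and y: "continuous_on {- \<rho>..<S} y" "\<And>t. 0 < t \<Longrightarrow> t < S \<Longrightarrow> has_caputo_derivative_vec \<alpha> y (rhs y t) t"
    and init: "\<And>s. - \<rho> \<le> s \<Longrightarrow> s \<le> 0 \<Longrightarrow> x s = y s"
    and t: "0 \<le> t" "t < S"
  shows "x t = y t"
proof -
  have volt: "z s $ i = z 0 $ i + rl_integral (\<alpha> $ i) (\<lambda>s. rhs z s $ i) s"
    if z: "continuous_on {- \<rho>..<S} z" "\<And>t. 0 < t \<Longrightarrow> t < S \<Longrightarrow> has_caputo_derivative_vec \<alpha> z (rhs z t) t"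
      and s: "0 \<le> s" "s \<le> t" for z s i
  proof (rule caputo_imp_volterra[of "\<alpha> $ i" S])
    show "continuous_on {0..<S} (\<lambda>s. z s $ i)"
      using z(1) \<rho>_nonneg by (intro continuous_on_component) (auto intro: continuous_on_subset)
    have "continuous_on {0..<S} (rhs z)"
      unfolding continuous_on_eq_continuous_within
    proof
      fix u assume u: "u \<in> {0..<S}"
      define S' where "S' = (u + S) / 2"
      have S': "u < S'" "S' < S" using u by (auto simp: S'_def)
      have "continuous_on {0..S'} (rhs z)"
        using S' by (intro continuous_on_rhs continuous_on_subset[OF z(1)]) auto
      then have "continuous (at u within {0..S'}) (rhs z)"
        using u S' by (auto simp: continuous_on_eq_continuous_within)
      moreover have "at u within {0..<S} = at u within {0..S'}"
        by (rule at_within_nhd[of _ "{..<S'}"]) (use u S' in auto)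
      ultimately show "continuous (at u within {0..<S}) (rhs z)" by simp
    qed
    then show "continuous_on {0..<S} (\<lambda>s. rhs z s $ i)" by (rule continuous_on_component)
    show "has_caputo_derivative (\<alpha> $ i) (\<lambda>s. z s $ i) (rhs z s $ i) s" if "0 < s" "s < S" for s
      using z(2)[OF that] by (simp add: has_caputo_derivative_vec_def)
  qed (use order s t in auto)
  have xt: "continuous_on {- \<rho>..t} x" and yt: "continuous_on {- \<rho>..t} y"
    using x(1) y(1) t by (auto intro: continuous_on_subset)
  have "bounded (x ` {- \<rho>..t})" "bounded (y ` {- \<rho>..t})"
    using compact_continuous_image[OF xt] compact_continuous_image[OF yt] compact_imp_bounded by auto
  then obtain Rx Ry where "\<And>s. s \<in> {- \<rho>..t} \<Longrightarrow> norm (x s) \<le> Rx" "\<And>s. s \<in> {- \<rho>..t} \<Longrightarrow> norm (y s) \<le> Ry"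
    unfolding bounded_iff by blast
  then have R: "norm (x s) \<le> max Rx Ry" "norm (y s) \<le> max Rx Ry" if "- \<rho> \<le> s" "s \<le> t" for s
    using that by (auto simp: le_max_iff_disj)
  obtain Lf Lg where L: "0 \<le> Lf" "\<And>j. 0 \<le> Lg j"
    "\<And>a b. norm a \<le> max Rx Ry \<Longrightarrow> norm b \<le> max Rx Ry \<Longrightarrow> norm (f a - f b) \<le> Lf * norm (a - b)"
    "\<And>j a b. j \<in> {1..m} \<Longrightarrow> norm a \<le> max Rx Ry \<Longrightarrow> norm b \<le> max Rx Ry \<Longrightarrow> norm (g j a - g j b) \<le> Lg j * norm (a - b)"
    using fields_lipschitz[of "max Rx Ry"] by blast
  show ?thesis
  proof (rule volterra_unique[of \<alpha> t x y "rhs x" "rhs y" "x 0" "Lf + (\<Sum>j=1..m. Lg j)"])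
    show "continuous_on {0..t} x" "continuous_on {0..t} y"
      using xt yt \<rho>_nonneg by (auto intro: continuous_on_subset)
    show "continuous_on {0..t} (rhs x)" "continuous_on {0..t} (rhs y)"
      using xt yt by (auto intro: continuous_on_rhs)
    show "x s $ i = x 0 $ i + rl_integral (\<alpha> $ i) (\<lambda>s. rhs x s $ i) s" if "0 \<le> s" "s \<le> t" for s i
      using volt[OF x that] .
    show "y s $ i = x 0 $ i + rl_integral (\<alpha> $ i) (\<lambda>s. rhs y s $ i) s" if "0 \<le> s" "s \<le> t" for s i
      using volt[OF y that, of i] init[of 0] \<rho>_nonneg by simp
    show "0 \<le> Lf + (\<Sum>j=1..m. Lg j)" using L by (intro add_nonneg_nonneg sum_nonneg) auto
    fix s D assume s: "0 \<le> s" "s \<le> t" and D: "\<And>u. 0 \<le> u \<Longrightarrow> u \<le> s \<Longrightarrow> norm (x u - y u) \<le> D"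
    have D0: "0 \<le> D" using D[of 0] s norm_ge_zero order_trans by blast
    have D': "norm (x u - y u) \<le> D" if "- \<rho> \<le> u" "u \<le> s" for u
      using D[of u] init[of u] that D0 by (cases "0 \<le> u") auto
    have diff: "rhs x s - rhs y s = (f (x s) - f (y s)) + (\<Sum>j=1..m. g j (x (s - \<tau> j s)) - g j (y (s - \<tau> j s)))"
      by (simp add: rhs_def sum_subtractf)
    have "norm (rhs x s - rhs y s) \<le> norm (f (x s) - f (y s)) + (\<Sum>j=1..m. norm (g j (x (s - \<tau> j s)) - g j (y (s - \<tau> j s))))"
      unfolding diff by (intro order_trans[OF norm_triangle_ineq] add_left_mono norm_sum)
    also have "\<dots> \<le> Lf * D + (\<Sum>j=1..m. Lg j * D)"
    proof (intro add_mono sum_mono)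
      have "norm (f (x s) - f (y s)) \<le> Lf * norm (x s - y s)" using L(3) R s \<rho>_nonneg by simp
      also have "\<dots> \<le> Lf * D" using D'[of s] s \<rho>_nonneg L(1) by (intro mult_left_mono) auto
      finally show "norm (f (x s) - f (y s)) \<le> Lf * D" .
      fix j assume j: "j \<in> {1..m}"
      have u: "- \<rho> \<le> s - \<tau> j s" "s - \<tau> j s \<le> s" using delay_range[OF j s(1)] s by auto
      have "norm (g j (x (s - \<tau> j s)) - g j (y (s - \<tau> j s))) \<le> Lg j * norm (x (s - \<tau> j s) - y (s - \<tau> j s))"
        using L(4)[OF j] R u s by simp
      also have "\<dots> \<le> Lg j * D" using D'[OF u] L(2) by (intro mult_left_mono) auto
      finally show "norm (g j (x (s - \<tau> j s)) - g j (y (s - \<tau> j s))) \<le> Lg j * D" .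
    qed
    finally show "norm (rhs x s - rhs y s) \<le> (Lf + (\<Sum>j=1..m. Lg j)) * D"
      by (simp add: distrib_right sum_distrib_right)
  qed (use order t in auto)
qed

lemma global_solution_is_maximal:
  assumes w: "is_solution \<alpha> f m g \<tau> \<rho> \<phi> \<infinity> w"
  shows "is_maximal_solution \<alpha> f m g \<tau> \<rho> \<phi> \<infinity> w"
  unfolding is_maximal_solution_def
proof (intro conjI allI impI)
  show "is_solution \<alpha> f m g \<tau> \<rho> \<phi> \<infinity> w" by (rule w)
  fix T' w' assume w': "is_solution \<alpha> f m g \<tau> \<rho> \<phi> T' w'"
  show "T' \<le> \<infinity>" by simp
  fix t assume t: "- \<rho> \<le> t" "ereal t < T'"
  show "w' t = w t"
  proof (cases "t \<le> 0")
    case True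
    then show ?thesis using w w' t by (simp add: is_solution_def)
  next
    case False
    obtain S where S: "ereal t < ereal S" "ereal S < T'" using ereal_dense2[OF t(2)] by blast
    have lt: "ereal s < T'" if "s < S" for s
      using S(2) that by (meson less_ereal.simps(1) less_trans)
    show ?thesis
    proof (rule solutions_agree[of S])
      show "continuous_on {- \<rho>..<S} w'"
        using w' lt unfolding is_solution_def by (auto elim!: continuous_on_subset)
      show "continuous_on {- \<rho>..<S} w"
        using w unfolding is_solution_def by (auto elim!: continuous_on_subset)
      show "has_caputo_derivative_vec \<alpha> w' (rhs w' s) s" if "0 < s" "s < S" for s
        using w' that lt unfolding is_solution_def rhs_def by blast
      show "has_caputo_derivative_vec \<alpha> w (rhs w s) s" if "0 < s" "s < S" for s
        using w that unfolding is_solution_def rhs_def by simp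
    qed (use w w' False S in \<open>auto simp: is_solution_def\<close>)
  qed
qed

text \<open>The right hand side along the profile times \<open>v\<close> is compared with the Caputo derivative of the same
function. After division by \<open>w\<^sup>p\<close> it remains to see that a quantity is negative whose limit is
\<open>f(v) + \<Sum>\<^sub>j g\<^sub>j(v)\<close> as \<open>K\<close> tends to infinity.\<close>

lemma supersolution_exists:
  assumes v: "vec_strict_less 0 v" "f v + (\<Sum>j=1..m. g j v) \<prec> 0"
    and b: "0 < b" "\<And>i. b * p \<le> \<alpha> $ i"
  obtains K where "0 < K"
    "\<And>t i. 0 \<le> t \<Longrightarrow> rhs (\<lambda>t. decay_profile b K t *\<^sub>R v) t $ i
       \<le> - (v $ i * frac_integral (1 - \<alpha> $ i) (decay_rate b K) t)"
proof -
  have v0: "0 \<le> v" "\<And>i. 0 < v $ i" using v(1) by (auto simp: vec_strict_less_def less_eq_vec_def less_imp_le)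
  have "\<exists>C>0. \<forall>K t. 0 < K \<longrightarrow> 0 \<le> t \<longrightarrow> frac_integral (1 - \<alpha> $ i) (decay_rate b K) t \<le> C * (K + t) powr (- \<alpha> $ i)" for i
    using frac_decay_rate_le[of "\<alpha> $ i" b] order b by metis
  then obtain C where C: "\<And>i. 0 < C i"
    "\<And>i K t. 0 < K \<Longrightarrow> 0 \<le> t \<Longrightarrow> frac_integral (1 - \<alpha> $ i) (decay_rate b K) t \<le> C i * (K + t) powr (- \<alpha> $ i)"
    by metis
  define G where "G = (\<lambda>i. \<Sum>j=1..m. g j v $ i)"
  have gv: "0 \<le> g j v $ i" if "j \<in> {1..m}" for i j
    using g_mono[OF that order_refl v0(1)] g_0[OF that] by (simp add: less_eq_vec_def)
  have "\<forall>\<^sub>F K in at_top. f v $ i + (1 + \<rho> / K) powr (b * p) * G i + v $ i * (C i * K powr (- \<alpha> $ i)) < 0" for i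
  proof -
    have "((\<lambda>K. f v $ i + (1 + \<rho> / K) powr (b * p) * G i + v $ i * (C i * K powr (- \<alpha> $ i))) \<longlongrightarrow>
       f v $ i + (1 + 0) powr (b * p) * G i + v $ i * (C i * 0)) at_top"
      using order[of i]
      by (intro tendsto_intros tendsto_neg_powr filterlim_ident tendsto_divide_0[OF tendsto_const]
            filterlim_at_top_imp_at_infinity) auto
    moreover have "f v $ i + (1 + 0) powr (b * p) * G i + v $ i * (C i * 0) < 0"
      using v(2) by (simp add: vec_strict_less_def G_def)
    ultimately show ?thesis by (rule order_tendstoD)
  qed
  then have "\<forall>\<^sub>F K in at_top. \<forall>i. f v $ i + (1 + \<rho> / K) powr (b * p) * G i + v $ i * (C i * K powr (- \<alpha> $ i)) < 0"
    by (rule eventually_all_finite)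
  then have "\<forall>\<^sub>F K in at_top. (\<forall>i. f v $ i + (1 + \<rho> / K) powr (b * p) * G i + v $ i * (C i * K powr (- \<alpha> $ i)) < 0) \<and> 0 < K"
    using eventually_gt_at_top[of 0] by eventually_elim simp
  then obtain K where K: "0 < K"
    "\<And>i. f v $ i + (1 + \<rho> / K) powr (b * p) * G i + v $ i * (C i * K powr (- \<alpha> $ i)) < 0"
    by (metis (no_types, lifting) eventually_happens trivial_limit_at_top_linorder)
  define w where "w = decay_profile b K"
  have w: "0 < w t" "w t \<le> 1" for t
    using decay_profile_pos[OF K(1)] decay_profile_le_1[OF b(1) K(1)] by (auto simp: w_def)
  define c where "c = 1 + \<rho> / K"
  have c: "1 \<le> c" using \<rho>_nonneg K by (simp add: c_def)
  have "rhs (\<lambda>t. w t *\<^sub>R v) t $ i \<le> - (v $ i * frac_integral (1 - \<alpha> $ i) (decay_rate b K) t)"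
    if t: "0 \<le> t" for t i
  proof -
    have wt: "w t powr p = (1 + t / K) powr (- (b * p))"
      using t by (simp add: w_def decay_profile_def powr_powr)
    have gj: "g j (w (t - \<tau> j t) *\<^sub>R v) $ i \<le> c powr (b * p) * w t powr p * g j v $ i" if j: "j \<in> {1..m}" for j
    proof -
      let ?s = "t - \<tau> j t"
      \<comment> \<open>A delay of at most \<open>\<rho>\<close> costs the profile no more than a factor \<open>c\<close> to the power \<open>b\<close>.\<close>
      have "1 + t / K \<le> c * (1 + max 0 ?s / K)"
      proof -
        have "t \<le> \<rho> + max 0 ?s" using delay_range[OF j t] by auto
        then have "1 + t / K \<le> 1 + (\<rho> + max 0 ?s) / K" using K by (simp add: divide_right_mono)
        also have "\<dots> \<le> (1 + \<rho> / K) * (1 + max 0 ?s / K)"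
          using \<rho>_nonneg K by (simp add: distrib_left distrib_right add_divide_distrib)
        finally show ?thesis by (simp add: c_def)
      qed
      then have "(c * (1 + max 0 ?s / K)) powr (- b) \<le> (1 + t / K) powr (- b)"
        using b t K by (intro powr_mono2') (auto intro!: add_pos_nonneg)
      then have "c powr (- b) * w ?s \<le> w t"
        using c profile_base_pos[OF K(1), of ?s] t by (simp add: powr_mult w_def decay_profile_def)
      then have "c powr b * (c powr (- b) * w ?s) \<le> c powr b * w t" by (intro mult_left_mono) auto
      then have ws: "w ?s \<le> c powr b * w t" using c by (simp add: powr_minus mult.assoc[symmetric])
      have "w ?s powr q j \<le> w ?s powr p" using w[of ?s] q_ge_p[OF j] by (intro powr_mono') auto
      also have "\<dots> \<le> (c powr b * w t) powr p" using ws w[of ?s] p_ge_1 by (intro powr_mono2) auto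
      also have "\<dots> = c powr (b * p) * w t powr p" using w[of t] by (simp add: powr_mult powr_powr)
      finally have "w ?s powr q j * g j v $ i \<le> c powr (b * p) * w t powr p * g j v $ i"
        using gv[OF j] by (rule mult_right_mono)
      then show ?thesis using g_homogeneous[OF j] w[of ?s] by (simp add: homogeneous_def)
    qed
    have "v $ i * frac_integral (1 - \<alpha> $ i) (decay_rate b K) t \<le> v $ i * (C i * (K + t) powr (- \<alpha> $ i))"
      using C(2)[OF K(1) t] v0(2)[of i] by (intro mult_left_mono) auto
    also have "(K + t) powr (- \<alpha> $ i) = K powr (- \<alpha> $ i) * (1 + t / K) powr (- \<alpha> $ i)"
    proof -
      have "K + t = K * (1 + t / K)" using K by (simp add: field_simps)
      then show ?thesis using K t by (simp add: powr_mult)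
    qed
    also have "v $ i * (C i * (K powr (- \<alpha> $ i) * (1 + t / K) powr (- \<alpha> $ i)))
       \<le> v $ i * (C i * (K powr (- \<alpha> $ i) * w t powr p))"
      unfolding wt using b(2)[of i] K t C(1)[of i] v0(2)[of i]
      by (intro mult_left_mono powr_mono) auto
    finally have G_le: "v $ i * frac_integral (1 - \<alpha> $ i) (decay_rate b K) t \<le> v $ i * (C i * K powr (- \<alpha> $ i)) * w t powr p"
      by (simp add: mult.assoc)
    have "rhs (\<lambda>t. w t *\<^sub>R v) t $ i = w t powr p * f v $ i + (\<Sum>j=1..m. g j (w (t - \<tau> j t) *\<^sub>R v) $ i)"
      using f_homogeneous w[of t] by (simp add: rhs_def homogeneous_def)
    also have "\<dots> \<le> w t powr p * f v $ i + (\<Sum>j=1..m. c powr (b * p) * w t powr p * g j v $ i)"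
      using gj by (intro add_left_mono sum_mono)
    also have "\<dots> = w t powr p * (f v $ i + c powr (b * p) * G i)"
      by (simp add: G_def sum_distrib_left distrib_left ac_simps)
    also have "\<dots> \<le> w t powr p * (- (v $ i * (C i * K powr (- \<alpha> $ i))))"
      using K(2)[of i] by (intro mult_left_mono) (auto simp: c_def)
    also have "\<dots> \<le> - (v $ i * frac_integral (1 - \<alpha> $ i) (decay_rate b K) t)"
      using G_le by (simp add: mult.commute)
    finally show ?thesis .
  qed
  then show thesis using that K(1) unfolding w_def by blast
qed

text \<open>The truncated system is solved globally, and the maximum principle is applied to each component of
\<open>x\<close> and of \<open>U - x\<close>, where \<open>U\<close> is the supersolution. If \<open>x\<^sub>i < 0\<close>, the truncated argument has \<open>i\<close>-th
component 0 and the right hand side is nonnegative there. If \<open>x\<^sub>i > U\<^sub>i\<close>, the truncated argument agrees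
with \<open>U\<close> in its \<open>i\<close>-th component and lies below \<open>U\<close>, so the right hand side is at most that of \<open>U\<close>. Neither
case needs information on the other components of \<open>x\<close>, which are truncated as well.\<close>

lemma solution_below_supersolution:
  assumes v: "0 \<le> v" and b: "0 < b" and K: "0 < K"
    and super: "\<And>t i. 0 \<le> t \<Longrightarrow> rhs (\<lambda>t. decay_profile b K t *\<^sub>R v) t $ i
       \<le> - (v $ i * frac_integral (1 - \<alpha> $ i) (decay_rate b K) t)"
    and \<phi>: "continuous_on {- \<rho>..0} \<phi>" "\<And>s. s \<in> {- \<rho>..0} \<Longrightarrow> 0 \<le> \<phi> s \<and> \<phi> s \<le> v"
  obtains x where "is_solution \<alpha> f m g \<tau> \<rho> \<phi> \<infinity> x"
    "\<And>t. 0 \<le> t \<Longrightarrow> 0 \<le> x t \<and> x t \<le> decay_profile b K t *\<^sub>R v"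
proof -
  define U where "U = (\<lambda>t. decay_profile b K t *\<^sub>R v)"
  have w: "0 < decay_profile b K t" "decay_profile b K t \<le> 1" for t
    using decay_profile_pos[OF K] decay_profile_le_1[OF b K] by auto
  have U: "0 \<le> U t" "U t \<le> v" for t
    using w[of t] v by (auto simp: U_def less_eq_vec_def mult_left_le_one_le less_imp_le)
  have Uc: "continuous_on S U" for S
    unfolding U_def by (intro continuous_intros continuous_on_decay_profile K)
  define y where "y = (\<lambda>x t. trunc_below (U t) (x t :: real ^ 'd))"
  have y: "0 \<le> y x t" "y x t \<le> U t" "norm (y x t) \<le> norm v" for x t
  proof -
    show b1: "0 \<le> y x t" "y x t \<le> U t" using trunc_below_bounds[OF U(1)] by (auto simp: y_def)
    show "norm (y x t) \<le> norm v" using b1 U(2)[of t] by (intro norm_mono_nonneg) auto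
  qed
  define N where "N = (\<lambda>x t. rhs (y x) (max 0 t))"
  obtain Lf Lg where L: "0 \<le> Lf" "\<And>j. 0 \<le> Lg j"
    "\<And>a b. norm a \<le> norm v \<Longrightarrow> norm b \<le> norm v \<Longrightarrow> norm (f a - f b) \<le> Lf * norm (a - b)"
    "\<And>j a b. j \<in> {1..m} \<Longrightarrow> norm a \<le> norm v \<Longrightarrow> norm b \<le> norm v \<Longrightarrow> norm (g j a - g j b) \<le> Lg j * norm (a - b)"
    using fields_lipschitz[of "norm v"] by blast
  define \<psi> where "\<psi> = (\<lambda>t. \<phi> (max (- \<rho>) (min 0 t)))"
  have \<psi>: "0 \<le> \<psi> t" "\<psi> t \<le> v" for t using \<phi>(2)[of "max (- \<rho>) (min 0 t)"] \<rho>_nonneg by (auto simp: \<psi>_def)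
  have "continuous_on UNIV \<psi>"
    unfolding \<psi>_def using \<rho>_nonneg by (intro continuous_on_compose2[OF \<phi>(1)] continuous_intros) auto
  then obtain x where x: "continuous_on UNIV x"
    "\<And>t i. x t $ i = \<psi> t $ i + rl_integral (\<alpha> $ i) (\<lambda>s. N x s $ i) t"
  proof (rule volterra_exists[OF order, of \<psi> "norm v" N "(Lf + (\<Sum>j=1..m. Lg j)) * norm v" "Lf + (\<Sum>j=1..m. Lg j)"])
    show "norm (\<psi> t) \<le> norm v" for t using \<psi> by (intro norm_mono_nonneg)
    show "0 \<le> Lf + (\<Sum>j=1..m. Lg j)" using L by (intro add_nonneg_nonneg sum_nonneg) auto
    fix x :: "real \<Rightarrow> real ^ 'd" assume x: "continuous_on UNIV x"
    have yc: "continuous_on UNIV (y x)" unfolding y_def by (intro continuous_on_trunc_below Uc x)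
    have "continuous_on UNIV (\<lambda>t. g j (y x (max 0 t - \<tau> j (max 0 t))))" if j: "j \<in> {1..m}" for j
    proof -
      have "continuous_on UNIV (\<lambda>t. max 0 t - \<tau> j (max 0 t))"
        by (intro continuous_intros continuous_on_compose2[OF delay_continuous[OF j]]) auto
      from continuous_on_compose2[OF yc this]
      have "continuous_on UNIV (\<lambda>t. y x (max 0 t - \<tau> j (max 0 t)))" by simp
      from continuous_on_compose2[OF g_continuous[OF j] this] show ?thesis by simp
    qed
    moreover have "continuous_on UNIV (\<lambda>t. f (y x (max 0 t)))"
    proof -
      have "continuous_on UNIV (\<lambda>t. max 0 t :: real)" by (intro continuous_intros)
      from continuous_on_compose2[OF yc this]
      have "continuous_on UNIV (\<lambda>t. y x (max 0 t))" by simp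
      from continuous_on_compose2[OF f_continuous this] show ?thesis by simp
    qed
    ultimately show "continuous_on UNIV (N x)"
      unfolding N_def rhs_def by (intro continuous_on_add continuous_on_sum) auto
  next
    fix x :: "real \<Rightarrow> real ^ 'd" and t
    have "norm (N x t) \<le> norm (f (y x (max 0 t))) + (\<Sum>j=1..m. norm (g j (y x (max 0 t - \<tau> j (max 0 t)))))"
      unfolding N_def rhs_def by (intro order_trans[OF norm_triangle_ineq] add_left_mono norm_sum)
    also have "\<dots> \<le> Lf * norm v + (\<Sum>j=1..m. Lg j * norm v)"
    proof (intro add_mono sum_mono)
      have f1: "norm (f a) \<le> Lf * norm v" if "norm a \<le> norm v" for a
        using L(3)[of a 0] f_0 that mult_left_mono[OF that L(1)] by simp
      show "norm (f (y x (max 0 t))) \<le> Lf * norm v" by (rule f1[OF y(3)])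
      fix j assume j: "j \<in> {1..m}"
      have g1: "norm (g j a) \<le> Lg j * norm v" if "norm a \<le> norm v" for a
        using L(4)[OF j, of a 0] g_0[OF j] that mult_left_mono[OF that L(2), of j] by simp
      show "norm (g j (y x (max 0 t - \<tau> j (max 0 t)))) \<le> Lg j * norm v" by (rule g1[OF y(3)])
    qed
    finally show "norm (N x t) \<le> (Lf + (\<Sum>j=1..m. Lg j)) * norm v"
      by (simp add: distrib_right sum_distrib_right)
  next
    fix x z :: "real \<Rightarrow> real ^ 'd" and t D assume t: "0 \<le> t" and D: "\<And>s. s \<le> t \<Longrightarrow> norm (x s - z s) \<le> D"
    have yD: "norm (y x s - y z s) \<le> D" if "s \<le> t" for s
      using D[OF that] trunc_below_contracts[of "U s" "x s" "z s"] by (simp add: y_def)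
    have diff: "N x t - N z t = (f (y x t) - f (y z t)) + (\<Sum>j=1..m. g j (y x (t - \<tau> j t)) - g j (y z (t - \<tau> j t)))"
      using t by (simp add: N_def rhs_def sum_subtractf)
    have "norm (N x t - N z t) \<le> norm (f (y x t) - f (y z t)) + (\<Sum>j=1..m. norm (g j (y x (t - \<tau> j t)) - g j (y z (t - \<tau> j t))))"
      unfolding diff by (intro order_trans[OF norm_triangle_ineq] add_left_mono norm_sum)
    also have "\<dots> \<le> Lf * D + (\<Sum>j=1..m. Lg j * D)"
    proof (intro add_mono sum_mono)
      have "norm (f (y x t) - f (y z t)) \<le> Lf * norm (y x t - y z t)" by (intro L(3) y(3))
      also have "\<dots> \<le> Lf * D" using yD L(1) by (intro mult_left_mono) auto
      finally show "norm (f (y x t) - f (y z t)) \<le> Lf * D" .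
      fix j assume j: "j \<in> {1..m}"
      have "norm (g j (y x (t - \<tau> j t)) - g j (y z (t - \<tau> j t))) \<le> Lg j * norm (y x (t - \<tau> j t) - y z (t - \<tau> j t))"
        by (intro L(4) j y(3))
      also have "\<dots> \<le> Lg j * D" using yD delay_range[OF j t] L(2) by (intro mult_left_mono) auto
      finally show "norm (g j (y x (t - \<tau> j t)) - g j (y z (t - \<tau> j t))) \<le> Lg j * D" .
    qed
    finally show "norm (N x t - N z t) \<le> (Lf + (\<Sum>j=1..m. Lg j)) * D"
      by (simp add: distrib_right sum_distrib_right)
  qed blast
  have yc: "continuous_on UNIV (y x)" unfolding y_def by (intro continuous_on_trunc_below Uc x)
  have Nc: "continuous_on {0..t} (\<lambda>s. N x s $ i)" for t i
  proof -
    have "continuous_on {0..t} (rhs (y x))"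
      by (rule continuous_on_rhs) (rule continuous_on_subset[OF yc], simp)
    then have "continuous_on {0..t} (N x)" by (rule continuous_on_eq) (simp add: N_def)
    then show ?thesis by (rule continuous_on_component)
  qed
  have \<psi>0: "\<psi> t = \<phi> 0" if "0 \<le> t" for t using that \<rho>_nonneg by (simp add: \<psi>_def)
  have lower: "0 \<le> x t $ i" if t: "0 \<le> t" for t i
  proof (rule volterra_weak_maximum_principle[where a="\<alpha> $ i" and T=t and F="\<lambda>s. N x s $ i" and z="\<lambda>s. x s $ i" and ?z0.0="\<phi> 0 $ i"])
    show "x s $ i = \<phi> 0 $ i + rl_integral (\<alpha> $ i) (\<lambda>s. N x s $ i) s" if "0 \<le> s" "s \<le> t" for s
      using x(2)[of s i] \<psi>0[OF that(1)] by simp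
    show "0 \<le> \<phi> 0 $ i" using \<phi>(2)[of 0] \<rho>_nonneg by (simp add: less_eq_vec_def)
    fix s assume s: "0 < s" "s \<le> t" and neg: "x s $ i < 0"
    have yi: "0 $ i = y x s $ i" using neg by (simp add: y_def trunc_below_def)
    have "0 \<le> f (y x s) $ i"
      using cooperative_quasimonotone[OF f_cooperative order_refl y(1) yi] f_0 by simp
    moreover have "0 \<le> g j (y x (s - \<tau> j s)) $ i" if j: "j \<in> {1..m}" for j
      using g_mono[OF j order_refl y(1)] g_0[OF j] by (simp add: less_eq_vec_def)
    ultimately show "0 \<le> N x s $ i"
      using s by (auto simp: N_def rhs_def intro!: add_nonneg_nonneg sum_nonneg)
  qed (use order[of i] t Nc in auto)
  have upper: "x t $ i \<le> U t $ i" if t: "0 \<le> t" for t i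
  proof -
    let ?G = "frac_integral (1 - \<alpha> $ i) (decay_rate b K)"
    let ?F = "\<lambda>s. (- (v $ i)) * ?G s - N x s $ i"
    have Gc: "continuous_on {0..t} ?G" using order[of i] by (intro continuous_on_frac_decay_rate K) auto
    have "0 \<le> U t $ i - x t $ i"
    proof (rule volterra_weak_maximum_principle[where a="\<alpha> $ i" and T=t and F="?F" and z="\<lambda>s. U s $ i - x s $ i" and ?z0.0="v $ i - \<phi> 0 $ i"])
      show "continuous_on {0..t} ?F" by (rule continuous_on_diff[OF continuous_on_mult_left[OF Gc] Nc])
      show "U s $ i - x s $ i = v $ i - \<phi> 0 $ i + rl_integral (\<alpha> $ i) ?F s" if s: "0 \<le> s" "s \<le> t" for s
      proof -
        let ?I = "\<lambda>r. indicator {0..t} r :: real"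
        have "rl_integral (\<alpha> $ i) ?F s = rl_integral (\<alpha> $ i) (\<lambda>r. (- (v $ i)) * (?I r * ?G r) - ?I r * N x r $ i) s"
          by (rule rl_integral_cong) (use s in simp)
        also have "\<dots> = (- (v $ i)) * rl_integral (\<alpha> $ i) ?G s - rl_integral (\<alpha> $ i) (\<lambda>r. N x r $ i) s"
          unfolding rl_integral_diff[OF order[of i, THEN conjunct1] bounded_borel_cmult[OF bounded_borel_continuous[OF Gc]]
              bounded_borel_continuous[OF Nc]] rl_integral_cmult rl_integral_cutoff[OF s(2)] ..
        finally have F: "rl_integral (\<alpha> $ i) ?F s =
            (- (v $ i)) * rl_integral (\<alpha> $ i) ?G s - rl_integral (\<alpha> $ i) (\<lambda>r. N x r $ i) s" .
        have "decay_profile b K s = 1 - rl_integral (\<alpha> $ i) ?G s"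
          by (rule decay_profile_volterra) (use order[of i] K s in auto)
        then have "U s $ i = (1 - rl_integral (\<alpha> $ i) ?G s) * v $ i"
          by (simp add: U_def)
        then have "U s $ i = v $ i - v $ i * rl_integral (\<alpha> $ i) ?G s"
          by (simp add: left_diff_distrib)
        then show ?thesis unfolding F using x(2)[of s i] \<psi>0[OF s(1)] by simp
      qed
      show "0 \<le> v $ i - \<phi> 0 $ i" using \<phi>(2)[of 0] \<rho>_nonneg by (simp add: less_eq_vec_def)
      fix s assume s: "0 < s" "s \<le> t" and neg: "U s $ i - x s $ i < 0"
      have yi: "y x s $ i = U s $ i"
        using neg U(1)[of s] by (simp add: y_def trunc_below_def less_eq_vec_def)
      have "rhs (y x) s $ i \<le> rhs U s $ i"
      proof -
        have "f (y x s) $ i \<le> f (U s) $ i" by (rule cooperative_quasimonotone[OF f_cooperative y(1,2) yi])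
        moreover have "g j (y x (s - \<tau> j s)) $ i \<le> g j (U (s - \<tau> j s)) $ i" if j: "j \<in> {1..m}" for j
          using g_mono[OF j y(1,2)] by (simp add: less_eq_vec_def)
        ultimately show ?thesis by (auto simp: rhs_def intro!: add_mono sum_mono)
      qed
      also have "\<dots> \<le> - (v $ i * ?G s)" using super[of s i] s by (simp add: U_def)
      finally show "0 \<le> ?F s" using s by (simp add: N_def)
    qed (use order[of i] t in auto)
    then show ?thesis by simp
  qed
  have nonpos: "x s = \<psi> s" if "s \<le> 0" for s
    using x(2)[of s] that by (simp add: vec_eq_iff rl_integral_nonpos_time)
  have yx: "y x s = x s" for s
    unfolding y_def
  proof (rule trunc_below_id)
    show "0 \<le> x s" using lower[of s] nonpos[of s] \<psi>(1)[of s] by (cases "0 \<le> s") (auto simp: less_eq_vec_def)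
    show "x s \<le> U s"
      using upper[of s] nonpos[of s] \<psi>(2)[of s]
      by (cases "0 \<le> s") (auto simp: less_eq_vec_def U_def decay_profile_nonpos_time)
  qed
  have Nx: "N x s = rhs x s" if "0 \<le> s" for s
    using that yx by (simp add: N_def rhs_def)
  have "is_solution \<alpha> f m g \<tau> \<rho> \<phi> \<infinity> x"
    unfolding is_solution_def
  proof (intro conjI ballI allI impI)
    show "continuous_on {t. - \<rho> \<le> t \<and> ereal t < \<infinity>} x" by (rule continuous_on_subset[OF x(1)]) simp
    show "x s = \<phi> s" if "s \<in> {- \<rho>..0}" for s using nonpos[of s] that by (simp add: \<psi>_def)
    fix t :: real assume t: "0 < t"
    have "has_caputo_derivative (\<alpha> $ i) (\<lambda>s. x s $ i) (N x t $ i) t" for i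
    proof (rule volterra_imp_caputo[where T = "t + 1" and F = "\<lambda>s. N x s $ i"])
      show "continuous_on {0..<t + 1} (\<lambda>s. N x s $ i)"
        by (rule continuous_on_subset[OF Nc[of "t + 1"]]) auto
      show "x s $ i = \<phi> 0 $ i + rl_integral (\<alpha> $ i) (\<lambda>s. N x s $ i) s" if "0 \<le> s" for s
        using x(2)[of s i] \<psi>0[OF that] by simp
    qed (use order[of i] t in auto)
    then show "has_caputo_derivative_vec \<alpha> x (f (x t) + (\<Sum>j = 1..m. g j (x (t - \<tau> j t)))) t"
      using Nx[of t] t by (simp add: has_caputo_derivative_vec_def rhs_def)
  qed simp
  moreover have "0 \<le> x t \<and> x t \<le> decay_profile b K t *\<^sub>R v" if "0 \<le> t" for t
    using lower[OF that] upper[OF that] by (simp add: less_eq_vec_def U_def)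
  ultimately show thesis using that by blast
qed

end

section \<open>Local Mittag-Leffler stability\<close>

theorem theorem3p5:
  fixes m :: nat
    and \<alpha> :: "real ^ 'd"
    and r :: "nat \<Rightarrow> real"
    and \<rho> :: real
    and \<tau> :: "nat \<Rightarrow> real \<Rightarrow> real"
    and f :: "real ^ 'd \<Rightarrow> real ^ 'd"
    and g :: "nat \<Rightarrow> real ^ 'd \<Rightarrow> real ^ 'd"
    and p :: real
    and q :: "nat \<Rightarrow> real"
  assumes "1 \<le> m"
    and "\<And>i. 0 < \<alpha> $ i \<and> \<alpha> $ i \<le> 1"
    and "\<And>j. j \<in> {1..m} \<Longrightarrow> 0 < r j"
    and "\<rho> = Max (r ` {1..m})"
    and "\<And>j. j \<in> {1..m} \<Longrightarrow> continuous_on {0..} (\<tau> j)"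
    and "\<And>j t. j \<in> {1..m} \<Longrightarrow> 0 \<le> t \<Longrightarrow> \<tau> j t \<in> {0..r j}"
    and "cooperative f"
    and "1 \<le> p"
    and "homogeneous p f"
    and "\<And>j. j \<in> {1..m} \<Longrightarrow> continuous_on UNIV (g j)"
    and "\<And>j. j \<in> {1..m} \<Longrightarrow> continuously_differentiable_on (g j) (UNIV - {0})"
    and "\<And>j. j \<in> {1..m} \<Longrightarrow> order_preserving (g j)"
    and "\<And>j. j \<in> {1..m} \<Longrightarrow> p \<le> q j"
    and "\<And>j. j \<in> {1..m} \<Longrightarrow> homogeneous (q j) (g j)"
    and "\<exists>v. 0 \<prec> v \<and> f v + (\<Sum>j=1..m. g j v) \<prec> 0"
  shows "\<exists>\<delta>>0. \<exists>\<beta>>0. \<forall>\<phi>.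
    continuous_on {- \<rho>..0} \<phi> \<and> \<phi> ` {- \<rho>..0} \<subseteq> nonneg_orthant \<and>
    (SUP s\<in>{- \<rho>..0}. norm (\<phi> s)) < \<delta> \<longrightarrow>
    (\<exists>\<Phi>. is_maximal_solution \<alpha> f m g \<tau> \<rho> \<phi> \<infinity> \<Phi> \<and>
      (\<exists>c>0. \<exists>\<nu>>0. \<forall>t\<ge>0. norm (\<Phi> t) \<le> \<nu> * mittag_leffler \<beta> (- c * t powr \<beta>)))"
proof -
  have r_le: "r j \<le> \<rho>" if "j \<in> {1..m}" for j using assms(4) that by auto
  have "\<rho> \<in> r ` {1..m}" using assms(1,4) by (simp add: Max_in)
  then have \<rho>: "0 \<le> \<rho>" using assms(3) by force
  interpret cooperative_delay_system m \<alpha> \<rho> \<tau> f g p q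
  proof
    show "0 \<le> \<tau> j t \<and> \<tau> j t \<le> \<rho>" if "j \<in> {1..m}" "0 \<le> t" for j t
      using assms(6)[OF that] r_le[OF that(1)] by auto
  qed (use assms \<rho> in blast)+
  obtain v where v: "vec_strict_less 0 v" "f v + (\<Sum>j=1..m. g j v) \<prec> 0" using assms(15) by blast
  have vpos: "0 < v $ i" for i using v(1) by (simp add: vec_strict_less_def)
  have v0: "0 \<le> v" using vpos by (auto simp: less_eq_vec_def less_imp_le)
  have "v \<noteq> 0" using vpos by (metis less_irrefl zero_index)
  then have nv: "0 < norm v" by simp
  define a where "a = Min (range (\<lambda>i. \<alpha> $ i))"
  have a: "0 < a" "\<And>i. a \<le> \<alpha> $ i" unfolding a_def using assms(2) by (auto simp: Min_gr_iff)
  then have "a \<le> 1" using assms(2) order_trans by blast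
  \<comment> \<open>The supersolution requires \<open>\<beta> p \<le> \<alpha>\<^sub>i\<close>; the factor 2 ensures \<open>\<beta> < 1\<close> also when \<open>a = p = 1\<close>.\<close>
  define \<beta> where "\<beta> = a / (2 * p)"
  have \<beta>: "0 < \<beta>" "\<beta> < 1" using a \<open>a \<le> 1\<close> assms(8) by (auto simp: \<beta>_def divide_simps)
  have \<beta>p: "\<beta> * p \<le> \<alpha> $ i" for i
  proof -
    have "\<beta> * p = a / 2" using assms(8) by (simp add: \<beta>_def)
    then show ?thesis using a(1) a(2)[of i] by simp
  qed
  obtain K where K: "0 < K"
    "\<And>t i. 0 \<le> t \<Longrightarrow> rhs (\<lambda>t. decay_profile \<beta> K t *\<^sub>R v) t $ i
       \<le> - (v $ i * frac_integral (1 - \<alpha> $ i) (decay_rate \<beta> K) t)"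
    using supersolution_exists[OF v \<beta>(1) \<beta>p] by blast
  obtain c where c: "0 < c" "\<And>t. 0 \<le> t \<Longrightarrow> decay_profile \<beta> K t / 2 \<le> mittag_leffler \<beta> (- c * t powr \<beta>)"
    using mittag_leffler_ge_decay_profile[OF \<beta> K(1)] by blast
  define \<delta> where "\<delta> = Min (range (\<lambda>i. v $ i))"
  have \<delta>: "0 < \<delta>" "\<And>i. \<delta> \<le> v $ i" unfolding \<delta>_def using vpos by (auto simp: Min_gr_iff)
  have main: "\<exists>\<Phi>. is_maximal_solution \<alpha> f m g \<tau> \<rho> \<phi> \<infinity> \<Phi> \<and>
      (\<exists>c>0. \<exists>\<nu>>0. \<forall>t\<ge>0. norm (\<Phi> t) \<le> \<nu> * mittag_leffler \<beta> (- c * t powr \<beta>))"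
    if \<phi>: "continuous_on {- \<rho>..0} \<phi>" "\<phi> ` {- \<rho>..0} \<subseteq> nonneg_orthant" "(SUP s\<in>{- \<rho>..0}. norm (\<phi> s)) < \<delta>" for \<phi>
  proof -
    have "compact ((\<lambda>s. norm (\<phi> s)) ` {- \<rho>..0})"
      by (intro compact_continuous_image continuous_intros \<phi>) auto
    then have bdd: "bdd_above ((\<lambda>s. norm (\<phi> s)) ` {- \<rho>..0})"
      by (intro bounded_imp_bdd_above compact_imp_bounded)
    have \<phi>v: "0 \<le> \<phi> s \<and> \<phi> s \<le> v" if s: "s \<in> {- \<rho>..0}" for s
    proof
      show "0 \<le> \<phi> s" using subsetD[OF \<phi>(2) imageI[OF s]] by (simp add: nonneg_orthant_def)
      have "norm (\<phi> s) < \<delta>" using cSUP_upper[OF s bdd] \<phi>(3) by linarith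
      then have "\<phi> s $ i \<le> v $ i" for i
        using component_le_norm_cart[of "\<phi> s" i] \<delta>(2)[of i] by linarith
      then show "\<phi> s \<le> v" by (simp add: less_eq_vec_def)
    qed
    obtain \<Phi> where \<Phi>: "is_solution \<alpha> f m g \<tau> \<rho> \<phi> \<infinity> \<Phi>"
      "\<And>t. 0 \<le> t \<Longrightarrow> 0 \<le> \<Phi> t \<and> \<Phi> t \<le> decay_profile \<beta> K t *\<^sub>R v"
      using solution_below_supersolution[OF v0 \<beta>(1) K \<phi>(1) \<phi>v] by blast
    have "norm (\<Phi> t) \<le> (2 * norm v) * mittag_leffler \<beta> (- c * t powr \<beta>)" if t: "0 \<le> t" for t
    proof -
      have "norm (\<Phi> t) \<le> norm (decay_profile \<beta> K t *\<^sub>R v)" using \<Phi>(2)[OF t] by (intro norm_mono_nonneg) auto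
      also have "\<dots> = 2 * norm v * (decay_profile \<beta> K t / 2)" using decay_profile_pos[OF K(1), of \<beta> t] by simp
      also have "\<dots> \<le> (2 * norm v) * mittag_leffler \<beta> (- c * t powr \<beta>)"
        using c(2)[OF t] by (intro mult_left_mono) auto
      finally show ?thesis .
    qed
    moreover have "0 < 2 * norm v" using nv by simp
    ultimately have "\<exists>c>0. \<exists>\<nu>>0. \<forall>t\<ge>0. norm (\<Phi> t) \<le> \<nu> * mittag_leffler \<beta> (- c * t powr \<beta>)"
      using c(1) by metis
    then show ?thesis using global_solution_is_maximal[OF \<Phi>(1)] by (intro exI[of _ \<Phi>] conjI)
  qed
  show ?thesis
    by (rule exI[of _ \<delta>], rule conjI[OF \<delta>(1)], rule exI[of _ \<beta>], rule conjI[OF \<beta>(1)],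
        intro allI impI, elim conjE, rule main)
qed

end
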